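(* Let $k\ge 1$ be an integer, let $(S,\mathcal{I}_i)$, $i\in[k]$, be matroids on a common finite ground set $S$, let $\mathcal{I}=\bigcap_{i=1}^k\mathcal{I}_i$, and let $w:S\to\mathbb{R}_{\ge0}$ be injective. For $p=1-\frac{1}{2k}$, the Free-Order General Secretary algorithm (described in the context) returns a set $\mathrm{ALG}\in\mathcal{I}$ such that $$\mathbb{E}[w(\mathrm{ALG})]\ \ge\ \frac{1}{16k^2}\,w(\mathrm{OPT}),$$ where $\mathrm{OPT}$ is a maximum-weight set in $\mathcal{I}$.
   Context: Write $X+e=X\cup\{e\}$ and $w(X)=\sum_{x\in X}w(x)$. For each $i$ let $\mathrm{span}_i$ be the closure operator of the matroid $(S,\mathcal{I}_i)$ and set $\mathrm{Hull}(X)=\bigcup_{i=1}^k\mathrm{span}_i(X)$ for $X\subseteq S$. $\mathrm{Greedy}(X)$: process the elements of $X$ in decreasing order of $w$, starting from $\emptyset$, adding an element whenever the current set stays in $\mathcal{I}$; $\mathrm{Greedy}(X)$ is the final set. For $Y\subseteq S$, $\mathrm{Rel}(Y)=\{y\in S\setminus Y: y\in \mathrm{Greedy}(Y+y)\}$. Free-Order General Secretary algorithm with parameter $p$ (the system is known, the weights are revealed only when an element is observed; the algorithm chooses the order of observation): 1. Set $\mathrm{ALG}=\emptyset$. For each $e\in S$ choose $t_e$ independently and uniformly from $(0,1)$. Let $Y=\{e: t_e\in(0,p)\}$, $S_1=\{e: t_e\in[p,(1+p)/2)\}$, $S_2=\{e: t_e\in[(1+p)/2,1)\}$. 2. Observe,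 without accepting, all elements of $Y\cup S_1$. Let $U=S_2$ (unseen elements). Sort the elements of $\mathrm{Rel}(Y)\cap S_1$ in decreasing order of weight as $e_1,\dots,e_m$. 3. For $j=1,\dots,m$: let $Q=U\cap\mathrm{Hull}(\{e_1,\dots,e_j\})$; for each $f\in Q$ in arbitrary order, remove $f$ from $U$ and reveal it; if $f\in\mathrm{Rel}(Y)$, $w(f)>w(e_j)$ and $\mathrm{ALG}+f\in\mathcal{I}$, add $f$ to $\mathrm{ALG}$. 4. For each remaining $f\in U$ in arbitrary order: if $f\in\mathrm{Rel}(Y)$ and $\mathrm{ALG}+f\in\mathcal{I}$, add $f$ to $\mathrm{ALG}$. 5. Return $\mathrm{ALG}$. *)

theory Defs
  imports "HOL-Probability.Probability"
begin

definition matroid :: "'a set \<Rightarrow> 'a set set \<Rightarrow> bool" where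
  "matroid S \<I> \<longleftrightarrow>
     finite S \<and> (\<forall>A\<in>\<I>. A \<subseteq> S) \<and> {} \<in> \<I> \<and>
     (\<forall>A\<in>\<I>. \<forall>B. B \<subseteq> A \<longrightarrow> B \<in> \<I>) \<and>
     (\<forall>A\<in>\<I>. \<forall>B\<in>\<I>. card A < card B \<longrightarrow> (\<exists>x\<in>B - A. insert x A \<in> \<I>))"

definition matroid_rank :: "'a set set \<Rightarrow> 'a set \<Rightarrow> nat" where
  "matroid_rank \<I> X = Max (card ` {A \<in> \<I>. A \<subseteq> X})"

definition matroid_span :: "'a set \<Rightarrow> 'a set set \<Rightarrow> 'a set \<Rightarrow> 'a set" where
  "matroid_span S \<I> X = {x \<in> S. matroid_rank \<I> (insert x X) = matroid_rank \<I> X}"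

definition common_indep :: "nat \<Rightarrow> (nat \<Rightarrow> 'a set set) \<Rightarrow> 'a set set" where
  "common_indep k Is = (\<Inter>i\<in>{1..k}. Is i)"

definition Hull :: "'a set \<Rightarrow> nat \<Rightarrow> (nat \<Rightarrow> 'a set set) \<Rightarrow> 'a set \<Rightarrow> 'a set" where
  "Hull S k Is X = (\<Union>i\<in>{1..k}. matroid_span S (Is i) X)"

definition decreasing_list :: "('a \<Rightarrow> real) \<Rightarrow> 'a set \<Rightarrow> 'a list" where
  "decreasing_list w X = rev (sorted_key_list_of_set w X)"

definition Greedy :: "'a set set \<Rightarrow> ('a \<Rightarrow> real) \<Rightarrow> 'a set \<Rightarrow> 'a set" where
  "Greedy \<I> w X =
     fold (\<lambda>x A. if insert x A \<in> \<I> then insert x A else A) (decreasing_list w X) {}"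

definition Rel :: "'a set \<Rightarrow> 'a set set \<Rightarrow> ('a \<Rightarrow> real) \<Rightarrow> 'a set \<Rightarrow> 'a set" where
  "Rel S \<I> w Y = {y \<in> S - Y. y \<in> Greedy \<I> w (insert y Y)}"

definition reveal :: "'a set set \<Rightarrow> ('a \<Rightarrow> bool) \<Rightarrow> 'a \<Rightarrow> 'a set \<Rightarrow> 'a set" where
  "reveal \<I> ok f A = (if ok f \<and> insert f A \<in> \<I> then insert f A else A)"

text \<open>
  The algorithm is nondeterministic: whenever elements are to be handled in arbitrary order,
  every enumeration without repetition is allowed.  For a fixed split of the ground set into
  \<open>Y\<close>, \<open>S1\<close>, \<open>S2\<close>, the proposition \<open>fos_state S k Is w Y S1 S2 j U A\<close> says that after the
  first \<open>j\<close> rounds of the main loop the set of unseen elements can be \<open>U\<close> while the set of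
  accepted elements is \<open>A\<close>.  Lists are indexed from 0, so the element of index \<open>j\<close> is the one
  that drives round \<open>j + 1\<close>.
\<close>

definition fos_thresholds ::
  "'a set \<Rightarrow> nat \<Rightarrow> (nat \<Rightarrow> 'a set set) \<Rightarrow> ('a \<Rightarrow> real) \<Rightarrow> 'a set \<Rightarrow> 'a set \<Rightarrow> 'a list" where
  "fos_thresholds S k Is w Y S1 = decreasing_list w (Rel S (common_indep k Is) w Y \<inter> S1)"

inductive fos_state ::
  "'a set \<Rightarrow> nat \<Rightarrow> (nat \<Rightarrow> 'a set set) \<Rightarrow> ('a \<Rightarrow> real) \<Rightarrow> 'a set \<Rightarrow> 'a set \<Rightarrow> 'a set
     \<Rightarrow> nat \<Rightarrow> 'a set \<Rightarrow> 'a set \<Rightarrow> bool"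
  for S k Is w Y S1 S2
where
  init: "fos_state S k Is w Y S1 S2 0 S2 {}"
| round: "\<lbrakk> fos_state S k Is w Y S1 S2 j U A;
     es = fos_thresholds S k Is w Y S1; j < length es;
     Q = U \<inter> Hull S k Is (set (take (Suc j) es));
     distinct fs; set fs = Q;
     A' = fold (reveal (common_indep k Is)
                  (\<lambda>f. f \<in> Rel S (common_indep k Is) w Y \<and> w f > w (es ! j))) fs A \<rbrakk>
   \<Longrightarrow> fos_state S k Is w Y S1 S2 (Suc j) (U - Q) A'"

definition fos_result ::
  "'a set \<Rightarrow> nat \<Rightarrow> (nat \<Rightarrow> 'a set set) \<Rightarrow> ('a \<Rightarrow> real) \<Rightarrow> 'a set \<Rightarrow> 'a set \<Rightarrow> 'a set
     \<Rightarrow> 'a set \<Rightarrow> bool" where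
  "fos_result S k Is w Y S1 S2 ALG \<longleftrightarrow>
     (\<exists>U A fs. fos_state S k Is w Y S1 S2 (length (fos_thresholds S k Is w Y S1)) U A \<and>
        distinct fs \<and> set fs = U \<and>
        ALG = fold (reveal (common_indep k Is) (\<lambda>f. f \<in> Rel S (common_indep k Is) w Y)) fs A)"

definition arrival_times :: "'a set \<Rightarrow> ('a \<Rightarrow> real) measure" where
  "arrival_times S = Pi\<^sub>M S (\<lambda>_. uniform_measure lborel {0<..<1})"

text \<open>
  \<open>free_order_secretary S k Is w p t ALG\<close>: with parameter \<open>p\<close> and realised arrival times \<open>t\<close>,
  some execution returns \<open>ALG\<close>.
\<close>

definition free_order_secretary ::
  "'a set \<Rightarrow> nat \<Rightarrow> (nat \<Rightarrow> 'a set set) \<Rightarrow> ('a \<Rightarrow> real) \<Rightarrow> real \<Rightarrow> ('a \<Rightarrow> real) \<Rightarrow> 'a set \<Rightarrow> bool"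
where
  "free_order_secretary S k Is w p t ALG \<longleftrightarrow>
     fos_result S k Is w
       {e \<in> S. t e \<in> {0<..<p}} {e \<in> S. t e \<in> {p..<(1 + p) / 2}} {e \<in> S. t e \<in> {(1 + p) / 2..<1}} ALG"

lemma fos_state_exists:
  assumes "finite S2" "j \<le> length (fos_thresholds S k Is w Y S1)"
  shows "\<exists>U A. U \<subseteq> S2 \<and> fos_state S k Is w Y S1 S2 j U A"
  using assms(2)
proof (induction j)
  case 0
  show ?case by (rule exI[of _ S2], rule exI[of _ "{}"]) (simp add: fos_state.init)
next
  case (Suc j)
  then obtain U A where UA: "U \<subseteq> S2" "fos_state S k Is w Y S1 S2 j U A"
    using Suc_leD by metis
  let ?Q = "U \<inter> Hull S k Is (set (take (Suc j) (fos_thresholds S k Is w Y S1)))"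
  have "finite U" using UA(1) assms(1) by (rule finite_subset)
  then have "finite ?Q" by (rule finite_Int[OF disjI1])
  from finite_distinct_list[OF this] obtain fs where fs: "set fs = ?Q" "distinct fs"
    by (elim exE conjE)
  have "j < length (fos_thresholds S k Is w Y S1)" using Suc.prems by simp
  from fos_state.round[OF UA(2) refl this refl fs(2) fs(1) refl]
  obtain A' where A': "fos_state S k Is w Y S1 S2 (Suc j) (U - ?Q) A'" by (rule that)
  have "U - ?Q \<subseteq> S2" using UA(1) by (rule order_trans[OF Diff_subset])
  with A' show ?case by (intro exI[of _ "U - ?Q"] exI[of _ A'] conjI)
qed

lemma fos_result_exists:
  assumes "finite S2"
  shows "\<exists>ALG. fos_result S k Is w Y S1 S2 ALG"
proof -
  obtain U A where UA: "U \<subseteq> S2"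
    "fos_state S k Is w Y S1 S2 (length (fos_thresholds S k Is w Y S1)) U A"
    using fos_state_exists[OF assms order_refl, of S k Is w Y S1] by (elim exE conjE)
  have "finite U" using UA(1) assms by (rule finite_subset)
  from finite_distinct_list[OF this] obtain fs where "set fs = U" "distinct fs"
    by (elim exE conjE)
  with UA(2) have "fos_result S k Is w Y S1 S2
      (fold (reveal (common_indep k Is) (\<lambda>f. f \<in> Rel S (common_indep k Is) w Y)) fs A)"
    unfolding fos_result_def by (intro exI conjI) (assumption | rule refl)+
  then show ?thesis by (rule exI)
qed

lemma measurable_level_set:
  assumes S: "finite S" and B: "B \<in> sets borel"
  shows "(\<lambda>t. {e \<in> S. t e \<in> B}) \<in> arrival_times S \<rightarrow>\<^sub>M count_space (Pow S)"
proof -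
  let ?M = "arrival_times S" and ?h = "\<lambda>t. {e \<in> S. t e \<in> B}"
  have "?h -` {T} \<inter> space ?M \<in> sets ?M" if T: "T \<subseteq> S" for T
  proof -
    have sp: "space ?M = S \<rightarrow>\<^sub>E UNIV"
      by (simp add: arrival_times_def space_PiM)
    have eq: "?h t = T \<longleftrightarrow> (\<forall>e\<in>S. t e \<in> (if e \<in> T then B else - B))" for t
    proof -
      have "?h t = T \<longleftrightarrow> (\<forall>e\<in>S. e \<in> T \<longleftrightarrow> t e \<in> B)" using T by blast
      also have "\<dots> \<longleftrightarrow> (\<forall>e\<in>S. t e \<in> (if e \<in> T then B else - B))" by simp metis
      finally show ?thesis .
    qed
    have "?h -` {T} \<inter> space ?M = (\<Pi>\<^sub>E e\<in>S. if e \<in> T then B else - B)"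
      by (rule set_eqI)
        (simp only: vimage_eq Int_iff singleton_iff eq sp PiE_iff UNIV_I, blast)
    also have "\<dots> \<in> sets ?M"
      unfolding arrival_times_def using S B
      by (intro sets_PiM_I_finite) simp_all
    finally show ?thesis .
  qed
  then show ?thesis
    using S by (simp add: measurable_count_space_eq2 Pi_iff)
qed

text \<open>Orders can be chosen so that the weight of the returned set is a random variable.\<close>

lemma measurable_free_order_secretary_exists:
  assumes S: "finite S"
  shows "\<exists>ALG. (\<forall>t. free_order_secretary S k Is w p t (ALG t)) \<and>
     (\<lambda>t. sum w (ALG t)) \<in> borel_measurable (arrival_times S)"
proof -
  define F where "F Y S1 S2 = (SOME A. fos_result S k Is w Y S1 S2 A)" for Y S1 S2
  define ALG where "ALG t = F {e \<in> S. t e \<in> {0<..<p}} {e \<in> S. t e \<in> {p..<(1 + p) / 2}}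
     {e \<in> S. t e \<in> {(1 + p) / 2..<1}}" for t
  have "free_order_secretary S k Is w p t (ALG t)" for t
    unfolding free_order_secretary_def ALG_def F_def
    by (rule someI_ex, rule fos_result_exists) (use S in auto)
  moreover have "(\<lambda>t. sum w (ALG t)) \<in> borel_measurable (arrival_times S)"
  proof -
    let ?P = "count_space (Pow S)"
    let ?G = "\<lambda>(Y, S1, S2). sum w (F Y S1 S2)"
    have c: "countable (Pow S)" using S by (simp add: countable_finite)
    have P: "?P \<Otimes>\<^sub>M ?P \<Otimes>\<^sub>M ?P = count_space (Pow S \<times> Pow S \<times> Pow S)"
      using c by (simp add: pair_measure_countable)
    have G: "?G \<in> ?P \<Otimes>\<^sub>M ?P \<Otimes>\<^sub>M ?P \<rightarrow>\<^sub>M borel"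
      unfolding P by simp
    have "(\<lambda>t. ({e \<in> S. t e \<in> {0<..<p}}, {e \<in> S. t e \<in> {p..<(1 + p) / 2}},
        {e \<in> S. t e \<in> {(1 + p) / 2..<1}})) \<in> arrival_times S \<rightarrow>\<^sub>M ?P \<Otimes>\<^sub>M ?P \<Otimes>\<^sub>M ?P"
      by (intro measurable_Pair measurable_level_set[OF S]) simp_all
    from measurable_compose[OF this G] show ?thesis by (simp add: ALG_def)
  qed
  ultimately show ?thesis by blast
qed

end

theory Submission
  imports Defs
begin

text \<open>
  Let \<open>R = Rel(Y)\<close>. Whether \<open>f\<close> passes the greedy test depends only on the elements of \<open>Y\<close> heavier
  than \<open>f\<close>, so \<open>P(f \<in> R) = (1 - p)/p * P(f \<in> Greedy(Y))\<close>; as the greedy algorithm is a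
  \<open>k\<close>-approximation, \<open>E w(R) \<ge> (1 - p)/k * w(OPT)\<close>.

  Call \<open>f\<close> unspanned if it is not in the hull of the elements of \<open>R\<close> heavier than \<open>f\<close>. For each
  matroid the elements of \<open>R\<close> spanned by heavier elements of \<open>R\<close> carry in expectation at most a
  fraction \<open>1 - p\<close> of \<open>w(R)\<close>, so for \<open>p = 1 - 1/(2k)\<close> the unspanned ones carry at least half of it.

  Given \<open>Y\<close>, an unspanned \<open>f \<in> R\<close> is accepted with probability at least \<open>1/4\<close>: it lies in \<open>S2\<close> with
  probability \<open>1/2\<close>, and by the symmetry between \<open>R \<inter> S1\<close> and \<open>R \<inter> S2 - {f}\<close> it is, with
  conditional probability at least \<open>1/2\<close>, in the hull of a top segment of \<open>R \<inter> S1\<close> at least as soon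
  as in that of the corresponding segment of \<open>R \<inter> S2 - {f}\<close>. In that case nothing accepted before
  \<open>f\<close> is revealed can block \<open>f\<close>.
\<close>

subsection \<open>Rank and span in a matroid\<close>

lemma matroidD:
  assumes "matroid S \<I>"
  shows "finite S" "A \<in> \<I> \<Longrightarrow> A \<subseteq> S" "{} \<in> \<I>" "A \<in> \<I> \<Longrightarrow> B \<subseteq> A \<Longrightarrow> B \<in> \<I>"
    "A \<in> \<I> \<Longrightarrow> B \<in> \<I> \<Longrightarrow> card A < card B \<Longrightarrow> \<exists>x\<in>B - A. insert x A \<in> \<I>"
  using assms unfolding matroid_def by blast+

lemma finite_indep_subsets:
  assumes "matroid S \<I>" shows "finite {A \<in> \<I>. A \<subseteq> X}"
  by (rule finite_subset[of _ "Pow S"]) (use matroidD[OF assms] in auto)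

lemma card_le_rank:
  assumes "matroid S \<I>" "A \<in> \<I>" "A \<subseteq> X"
  shows "card A \<le> matroid_rank \<I> X"
  unfolding matroid_rank_def using assms finite_indep_subsets[OF assms(1)] by (intro Max_ge) auto

lemma rank_attained:
  assumes "matroid S \<I>"
  obtains A where "A \<in> \<I>" "A \<subseteq> X" "card A = matroid_rank \<I> X"
proof -
  have "matroid_rank \<I> X \<in> card ` {A \<in> \<I>. A \<subseteq> X}"
    unfolding matroid_rank_def using matroidD(3)[OF assms] finite_indep_subsets[OF assms]
    by (intro Max_in) auto
  then show thesis using that by auto
qed

lemma extend_to_rank:
  assumes m: "matroid S \<I>" and A: "A \<in> \<I>" "A \<subseteq> X"
  obtains B where "B \<in> \<I>" "A \<subseteq> B" "B \<subseteq> X" "card B = matroid_rank \<I> X"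
proof -
  have "\<exists>B. (B \<in> \<I> \<and> A \<subseteq> B \<and> B \<subseteq> X)
      \<and> (\<forall>C. C \<in> \<I> \<and> A \<subseteq> C \<and> C \<subseteq> X \<longrightarrow> card C \<le> card B)"
    by (rule ex_has_greatest_nat[of _ A _ "Suc (matroid_rank \<I> X)"])
      (use A card_le_rank[OF m] in \<open>auto simp: less_Suc_eq_le\<close>)
  then obtain B where B: "B \<in> \<I>" "A \<subseteq> B" "B \<subseteq> X"
    and max: "\<And>C. C \<in> \<I> \<Longrightarrow> A \<subseteq> C \<Longrightarrow> C \<subseteq> X \<Longrightarrow> card C \<le> card B"
    by blast
  obtain D where D: "D \<in> \<I>" "D \<subseteq> X" "card D = matroid_rank \<I> X"
    using rank_attained[OF m] .
  have "\<not> card B < card D"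
  proof
    assume "card B < card D"
    then obtain y where y: "y \<in> D - B" "insert y B \<in> \<I>"
      using matroidD(5)[OF m B(1) D(1)] by blast
    have "finite B" using matroidD(1,2)[OF m] B(1) finite_subset by metis
    then show False using max[OF y(2)] y(1) B D by auto
  qed
  then have "card B = matroid_rank \<I> X"
    using card_le_rank[OF m B(1,3)] D by simp
  then show thesis using that B by blast
qed

lemma rank_mono:
  assumes "matroid S \<I>" "X \<subseteq> Y"
  shows "matroid_rank \<I> X \<le> matroid_rank \<I> Y"
  by (metis assms card_le_rank order_trans rank_attained)

lemma rank_le_card:
  assumes "matroid S \<I>" "finite X"
  shows "matroid_rank \<I> X \<le> card X"
  by (metis assms card_mono rank_attained)

lemma rank_insert_le:
  assumes m: "matroid S \<I>"
  shows "matroid_rank \<I> (insert x X) \<le> Suc (matroid_rank \<I> X)"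
proof -
  obtain A where A: "A \<in> \<I>" "A \<subseteq> insert x X" "card A = matroid_rank \<I> (insert x X)"
    using rank_attained[OF m] .
  have "card A - 1 \<le> card (A - {x})" using card_Diff1_le by (simp add: card_Diff_singleton_if)
  also have "\<dots> \<le> matroid_rank \<I> X"
    by (rule card_le_rank[OF m]) (use A matroidD(4)[OF m] in auto)
  finally show ?thesis using A by simp
qed

text \<open>An \<open>x\<close> outside the span raises the rank of \<open>A\<close> above
  \<open>card A\<close>, so a maximum independent subset of \<open>insert x A\<close> can augment
  \<open>A\<close>, and \<open>x\<close> is the only element it can contribute.\<close>

lemma insert_indep_if_not_span:
  assumes m: "matroid S \<I>" and A: "A \<in> \<I>" and x: "x \<in> S" "x \<notin> matroid_span S \<I> A"
  shows "insert x A \<in> \<I>"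
proof -
  have "matroid_rank \<I> A < matroid_rank \<I> (insert x A)"
    using x rank_mono[OF m subset_insertI[of A x]] by (auto simp: matroid_span_def)
  moreover obtain B where B: "B \<in> \<I>" "B \<subseteq> insert x A" "card B = matroid_rank \<I> (insert x A)"
    using rank_attained[OF m] .
  ultimately have "card A < card B" using card_le_rank[OF m A subset_refl] by simp
  then show ?thesis using matroidD(5)[OF m A B(1)] B(2) by auto
qed

text \<open>A larger \<open>A\<close> would augment a maximum independent subset of \<open>X\<close>
  by some \<open>y\<close> of \<open>A\<close>, and then \<open>y\<close> would raise the rank of
  \<open>X\<close> although it is spanned.\<close>

lemma card_le_rank_if_spanned:
  assumes m: "matroid S \<I>" and A: "A \<in> \<I>" "A \<subseteq> matroid_span S \<I> X"
  shows "card A \<le> matroid_rank \<I> X"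
proof (rule ccontr)
  obtain B where B: "B \<in> \<I>" "B \<subseteq> X" "card B = matroid_rank \<I> X"
    using rank_attained[OF m] .
  assume "\<not> ?thesis"
  then obtain y where y: "y \<in> A - B" "insert y B \<in> \<I>"
    using matroidD(5)[OF m B(1) A(1)] B(3) by auto
  have "finite B" using matroidD(1,2)[OF m] B(1) finite_subset by metis
  then have "Suc (card B) \<le> matroid_rank \<I> (insert y X)"
    using card_le_rank[OF m y(2), of "insert y X"] y(1) B(2) by auto
  moreover have "y \<in> matroid_span S \<I> X" using y A by auto
  ultimately show False using B(3) by (simp add: matroid_span_def)
qed

text \<open>If \<open>x\<close> raised the rank of \<open>Y\<close>, a basis of \<open>X\<close>
  extended to a basis of \<open>Y\<close> could be augmented, and only by \<open>x\<close>. Then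
  \<open>x\<close> would extend the basis of \<open>X\<close> as well.\<close>

lemma span_mono:
  assumes m: "matroid S \<I>" and XY: "X \<subseteq> Y"
  shows "matroid_span S \<I> X \<subseteq> matroid_span S \<I> Y"
proof
  fix x assume x: "x \<in> matroid_span S \<I> X"
  show "x \<in> matroid_span S \<I> Y"
  proof (rule ccontr)
    assume "x \<notin> matroid_span S \<I> Y"
    then have lt: "matroid_rank \<I> Y < matroid_rank \<I> (insert x Y)"
      using x rank_mono[OF m subset_insertI[of Y x]] by (auto simp: matroid_span_def)
    obtain B where B: "B \<in> \<I>" "B \<subseteq> X" "card B = matroid_rank \<I> X"
      using rank_attained[OF m] .
    obtain B' where B': "B' \<in> \<I>" "B \<subseteq> B'" "B' \<subseteq> Y" "card B' = matroid_rank \<I> Y"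
      using extend_to_rank[OF m B(1), of Y] B(2) XY by blast
    obtain C where C: "C \<in> \<I>" "C \<subseteq> insert x Y" "card C = matroid_rank \<I> (insert x Y)"
      using rank_attained[OF m] .
    obtain y where y: "y \<in> C - B'" "insert y B' \<in> \<I>"
      using matroidD(5)[OF m B'(1) C(1)] lt B' C by auto
    have fin: "finite B" "finite B'"
      using matroidD(1,2)[OF m] B(1) B'(1) finite_subset by metis+
    have "y = x"
    proof (rule ccontr)
      assume "y \<noteq> x"
      then have "Suc (card B') \<le> matroid_rank \<I> Y"
        using card_le_rank[OF m y(2), of Y] y(1) C(2) B'(3) fin by auto
      then show False using B' by simp
    qed
    then have "insert x B \<in> \<I>" using matroidD(4)[OF m y(2)] B'(2) by blast
    then have "Suc (card B) \<le> matroid_rank \<I> (insert x X)"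
      using card_le_rank[OF m, of "insert x B" "insert x X"] B(2) B'(2) y(1) \<open>y = x\<close> fin
      by (auto simp: card_insert_if subset_insertI2 split: if_splits)
    then show False using x B by (simp add: matroid_span_def)
  qed
qed

text \<open>Insert the elements by decreasing weight: the new, lightest one either is spanned by
  those before it and leaves the rank unchanged, or is not counted as spanned and raises the rank by
  at most one.\<close>

lemma rank_add_spanned_le_card:
  fixes w :: "'a \<Rightarrow> real"
  assumes m: "matroid S \<I>" and X: "finite X" "X \<subseteq> S" and inj: "inj_on w S"
  shows "matroid_rank \<I> X + card {f \<in> X. f \<in> matroid_span S \<I> {g \<in> X. w g > w f}} \<le> card X"
  using X
proof (induction X rule: finite_ranking_induct[where f = "\<lambda>x. - w x"])
  case empty
  then show ?case using rank_le_card[OF m, of "{}"] by simp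
next
  case (insert x X)
  show ?case
  proof (cases "x \<in> X")
    case True
    then show ?thesis using insert by (simp add: insert_absorb)
  next
    case False
    let ?s = "matroid_span S \<I>"
    have gt: "w x < w y" if "y \<in> X" for y
      using insert(2)[OF that] inj insert.prems that False
      by (metis inj_on_eq_iff insert_subset less_eq_real_def neg_le_iff_le subset_iff)
    have eq: "{f \<in> insert x X. f \<in> ?s {g \<in> insert x X. w g > w f}}
        = {f \<in> X. f \<in> ?s {g \<in> X. w g > w f}} \<union> (if x \<in> ?s X then {x} else {})"
    proof -
      have 1: "{g \<in> insert x X. w g > w f} = {g \<in> X. w g > w f}" if "f \<in> X" for f
        using gt[OF that] by auto
      have 2: "{g \<in> insert x X. w g > w x} = X" using gt by auto
      show ?thesis using 1 2 by auto
    qed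
    have IH: "matroid_rank \<I> X + card {f \<in> X. f \<in> ?s {g \<in> X. w g > w f}} \<le> card X"
      using insert by simp
    show ?thesis
    proof (cases "x \<in> ?s X")
      case True
      then have "matroid_rank \<I> (insert x X) = matroid_rank \<I> X" by (simp add: matroid_span_def)
      moreover have "card {f \<in> insert x X. f \<in> ?s {g \<in> insert x X. w g > w f}}
         \<le> Suc (card {f \<in> X. f \<in> ?s {g \<in> X. w g > w f}})"
        unfolding eq using True insert(1) by (simp add: card_insert_if)
      ultimately show ?thesis using IH insert(1) False by simp
    next
      case nx: False
      then show ?thesis unfolding eq using IH insert(1) False rank_insert_le[OF m, of x X] by simp
    qed
  qed
qed

subsection \<open>Weighted sums and random subsets\<close>

text \<open>Abel summation. Splitting \<open>w y - c\<close> at the lightest weight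
  \<open>w x\<close> leaves the same sum over the other elements with \<open>c\<close> replaced by
  \<open>w x\<close>, plus \<open>w x - c\<close> times the total of \<open>u\<close>, which is the
  prefix sum at \<open>x\<close>. This is why \<open>c\<close> is arbitrary.\<close>

lemma weighted_sum_nonneg:
  fixes u w :: "'a \<Rightarrow> real"
  assumes "finite S" "inj_on w S" "\<And>x. x \<in> S \<Longrightarrow> c \<le> w x"
    and "\<And>y. y \<in> S \<Longrightarrow> 0 \<le> (\<Sum>x | x \<in> S \<and> w y \<le> w x. u x)"
  shows "0 \<le> (\<Sum>x\<in>S. u x * (w x - c))"
  using assms
proof (induction S arbitrary: c rule: finite_ranking_induct[where f = "\<lambda>x. - w x"])
  case empty
  then show ?case by simp
next
  case (insert x S)
  show ?case
  proof (cases "x \<in> S")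
    case True
    then show ?thesis using insert by (simp add: insert_absorb)
  next
    case False
    have gt: "w x < w y" if "y \<in> S" for y
      using insert(2)[OF that] insert.prems(1) that False
      by (metis inj_on_eq_iff insertCI less_eq_real_def neg_le_iff_le)
    have "0 \<le> (\<Sum>y\<in>S. u y * (w y - w x))"
    proof (rule insert.IH)
      show "inj_on w S" using insert.prems(1) by simp
      show "\<And>y. y \<in> S \<Longrightarrow> w x \<le> w y" using gt by (simp add: less_imp_le)
      fix y assume y: "y \<in> S"
      then have "{z. z \<in> insert x S \<and> w y \<le> w z} = {z. z \<in> S \<and> w y \<le> w z}" using gt[OF y] by auto
      then show "0 \<le> (\<Sum>z | z \<in> S \<and> w y \<le> w z. u z)"
        using insert.prems(3)[of y] y by simp
    qed
    moreover have "0 \<le> (\<Sum>y\<in>insert x S. u y)"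
    proof -
      have "{z. z \<in> insert x S \<and> w x \<le> w z} = insert x S" using gt by (auto simp: less_imp_le)
      then show ?thesis using insert.prems(3)[of x] by simp
    qed
    then have "0 \<le> (w x - c) * (\<Sum>y\<in>insert x S. u y)"
      using insert.prems(2)[of x] by (intro mult_nonneg_nonneg) auto
    moreover have "(\<Sum>y\<in>insert x S. u y * (w y - c))
        = (\<Sum>y\<in>S. u y * (w y - w x)) + (w x - c) * (\<Sum>y\<in>insert x S. u y)"
    proof -
      have "(\<Sum>y\<in>insert x S. u y * (w y - c))
        = (\<Sum>y\<in>insert x S. u y * (w y - w x) + (w x - c) * u y)"
        by (intro sum.cong) (auto simp: algebra_simps)
      also have "\<dots> = (\<Sum>y\<in>insert x S. u y * (w y - w x)) + (w x - c) * (\<Sum>y\<in>insert x S. u y)"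
        by (simp only: sum.distrib sum_distrib_left)
      finally show ?thesis using insert(1) False by simp
    qed
    ultimately show ?thesis by linarith
  qed
qed

text \<open>Reduces every weight comparison below to counting on the upper level sets of
  \<open>w\<close>.\<close>

lemma weighted_sum_mono:
  fixes u v w :: "'a \<Rightarrow> real"
  assumes "finite S" "inj_on w S" "\<And>x. x \<in> S \<Longrightarrow> 0 \<le> w x"
    and "\<And>y. y \<in> S \<Longrightarrow> (\<Sum>x | x \<in> S \<and> w y \<le> w x. u x) \<le> (\<Sum>x | x \<in> S \<and> w y \<le> w x. v x)"
  shows "(\<Sum>x\<in>S. u x * w x) \<le> (\<Sum>x\<in>S. v x * w x)"
proof -
  have "0 \<le> (\<Sum>x\<in>S. (v x - u x) * (w x - 0))"
    by (rule weighted_sum_nonneg) (use assms in \<open>auto simp: sum_subtractf\<close>)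
  then show ?thesis by (simp add: algebra_simps sum_subtractf)
qed

section \<open>Random subsets with independent membership\<close>

text \<open>The probability that \<open>Y\<close> is drawn when each element of \<open>S\<close> is
  taken independently with probability \<open>p\<close>. Expectations over the sample
  \<open>Y\<close> become finite sums, and integrals enter only with the arrival times.\<close>

definition bern :: "real \<Rightarrow> 'a set \<Rightarrow> 'a set \<Rightarrow> real" where
  "bern p S Y = p ^ card Y * (1 - p) ^ card (S - Y)"

lemma bern_nonneg: "0 \<le> p \<Longrightarrow> p \<le> 1 \<Longrightarrow> 0 \<le> bern p S Y"
  by (simp add: bern_def)

lemma sum_bern_insert:
  assumes "finite T" "f \<notin> T"
  shows "(\<Sum>Y\<in>Pow (insert f T). bern p (insert f T) Y * F Y)
    = (\<Sum>Y\<in>Pow T. bern p T Y * (p * F (insert f Y) + (1 - p) * F Y))"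
proof -
  have inj: "inj_on (insert f) (Pow T)" using assms(2) by (auto simp: inj_on_def insert_ident)
  have "(\<Sum>Y\<in>Pow (insert f T). bern p (insert f T) Y * F Y)
    = (\<Sum>Y\<in>Pow T. bern p (insert f T) Y * F Y) + (\<Sum>Y\<in>insert f ` Pow T. bern p (insert f T) Y * F Y)"
    unfolding Pow_insert using assms by (intro sum.union_disjoint) auto
  also have "(\<Sum>Y\<in>insert f ` Pow T. bern p (insert f T) Y * F Y)
    = (\<Sum>Y\<in>Pow T. bern p (insert f T) (insert f Y) * F (insert f Y))"
    using inj by (simp add: sum.reindex)
  also have "\<dots> = (\<Sum>Y\<in>Pow T. bern p T Y * (p * F (insert f Y)))"
  proof (rule sum.cong[OF refl])
    fix Y assume "Y \<in> Pow T"
    then have "f \<notin> Y" "finite Y" "insert f T - insert f Y = T - Y"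
      using assms finite_subset by auto
    then show "bern p (insert f T) (insert f Y) * F (insert f Y) = bern p T Y * (p * F (insert f Y))"
      by (simp add: bern_def)
  qed
  also have "(\<Sum>Y\<in>Pow T. bern p (insert f T) Y * F Y) = (\<Sum>Y\<in>Pow T. bern p T Y * ((1 - p) * F Y))"
  proof (rule sum.cong[OF refl])
    fix Y assume "Y \<in> Pow T"
    then have "f \<notin> Y" "insert f T - Y = insert f (T - Y)" "finite (T - Y)"
      using assms finite_subset by auto
    then show "bern p (insert f T) Y * F Y = bern p T Y * ((1 - p) * F Y)"
      using assms by (simp add: bern_def)
  qed
  finally show ?thesis by (simp only: distrib_left sum.distrib add.commute)
qed

lemma sum_bern: "finite S \<Longrightarrow> (\<Sum>Y\<in>Pow S. bern p S Y) = 1"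
proof (induction S rule: finite_induct)
  case empty
  then show ?case by (simp add: bern_def)
next
  case (insert f T)
  then show ?case using sum_bern_insert[of T f p "\<lambda>_. 1"] by simp
qed

lemma sum_bern_mem:
  assumes "finite S" "f \<in> S"
  shows "(\<Sum>Y\<in>Pow S. bern p S Y * of_bool (f \<in> Y)) = p"
proof -
  obtain T where S: "S = insert f T" "f \<notin> T" using assms(2) by (rule mk_disjoint_insert[elim_format]) blast
  have "(\<Sum>Y\<in>Pow S. bern p S Y * of_bool (f \<in> Y))
    = (\<Sum>Y\<in>Pow T. bern p T Y * (p * of_bool (f \<in> insert f Y) + (1 - p) * of_bool (f \<in> Y)))"
    unfolding S(1) using assms S by (intro sum_bern_insert) auto
  also have "\<dots> = (\<Sum>Y\<in>Pow T. bern p T Y * p)" using S by (intro sum.cong) auto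
  also have "\<dots> = p" using sum_bern[of T p] assms S by (simp flip: sum_distrib_right)
  finally show ?thesis .
qed

text \<open>Condition on the membership of all elements other than \<open>f\<close>:
  \<open>P\<close> is then fixed, while \<open>f\<close> is out or in with odds \<open>1 - p\<close>
  to \<open>p\<close>.\<close>

lemma sum_bern_swap:
  assumes "finite S" "f \<in> S" and inv: "\<And>Y. Y \<subseteq> S \<Longrightarrow> P (insert f Y) \<longleftrightarrow> P Y"
  shows "p * (\<Sum>Y\<in>Pow S. bern p S Y * of_bool (f \<notin> Y \<and> P Y))
    = (1 - p) * (\<Sum>Y\<in>Pow S. bern p S Y * of_bool (f \<in> Y \<and> P Y))"
proof -
  obtain T where S: "S = insert f T" "f \<notin> T" using assms(2) by (rule mk_disjoint_insert[elim_format]) blast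
  have T: "finite T" using assms S by simp
  have "p * (\<Sum>Y\<in>Pow S. bern p S Y * of_bool (f \<notin> Y \<and> P Y))
    = p * (\<Sum>Y\<in>Pow T. bern p T Y * ((1 - p) * of_bool (P Y)))"
    unfolding S(1) sum_bern_insert[OF T S(2)]
    by (rule arg_cong[where f = "\<lambda>x. p * x"], rule sum.cong) (use S in auto)
  moreover have "(1 - p) * (\<Sum>Y\<in>Pow S. bern p S Y * of_bool (f \<in> Y \<and> P Y))
    = (1 - p) * (\<Sum>Y\<in>Pow T. bern p T Y * (p * of_bool (P Y)))"
    unfolding S(1) sum_bern_insert[OF T S(2)]
    by (rule arg_cong[where f = "\<lambda>x. (1 - p) * x"], rule sum.cong) (use S inv in auto)
  ultimately show ?thesis by (simp add: sum_distrib_left algebra_simps)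
qed

subsection \<open>The greedy algorithm\<close>

context linorder
begin

lemma set_sorted_key_list_of_inj:
  assumes "inj_on f S" "X \<subseteq> S" "finite X"
  shows "set (sorted_key_list_of_set f X) = X"
proof -
  interpret folding_insort_key less_eq less S f by unfold_locales (rule assms)
  show ?thesis by (rule set_sorted_key_list_of_set[OF assms(2,3)])
qed

lemma sorted_sorted_key_list_of_inj:
  assumes "inj_on f S" "X \<subseteq> S" "finite X"
  shows "sorted_wrt (\<lambda>x y. f x < f y) (sorted_key_list_of_set f X)"
proof -
  interpret folding_insort_key less_eq less S f by unfold_locales (rule assms)
  have "sorted_wrt less (map f (sorted_key_list_of_set f X))"
    unfolding strict_sorted_iff
    using sorted_sorted_key_list_of_set[OF assms(2)] distinct_sorted_key_list_of_set[OF assms(2)]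
    by blast
  then show ?thesis by (simp add: sorted_wrt_map)
qed

text \<open>In the reversed list the lightest element comes last, so greedy on a set with a new
  lightest element is greedy on the old set followed by one test.\<close>

lemma sorted_key_list_of_insert_min:
  assumes "inj_on f S" "insert m X \<subseteq> S" "finite X" "\<And>x. x \<in> X \<Longrightarrow> f m < f x"
  shows "sorted_key_list_of_set f (insert m X) = m # sorted_key_list_of_set f X"
proof -
  interpret folding_insort_key less_eq less S f by unfold_locales (rule assms)
  have "m \<notin> X" using assms(4) by blast
  then have "sorted_key_list_of_set f (insert m X) = insort_key f m (sorted_key_list_of_set f X)"
    using sorted_key_list_of_set_insert[OF assms(2,3)] by blast
  also have "\<dots> = m # sorted_key_list_of_set f X"
    using assms set_sorted_key_list_of_set[of X]
    by (intro insort_is_Cons) (auto simp: less_imp_le)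
  finally show ?thesis .
qed

end

section \<open>Greedy on an intersection of matroids\<close>

locale matroid_intersection =
  fixes S :: "'a set" and k :: nat and Is :: "nat \<Rightarrow> 'a set set" and w :: "'a \<Rightarrow> real"
  assumes k: "k \<ge> 1" and mat: "\<And>i. i \<in> {1..k} \<Longrightarrow> matroid S (Is i)"
    and nonneg: "\<And>e. e \<in> S \<Longrightarrow> w e \<ge> 0" and inj: "inj_on w S"
begin

abbreviation "\<I> \<equiv> common_indep k Is"
abbreviation "clos \<equiv> Hull S k Is"
abbreviation "greedy \<equiv> Greedy \<I> w"
abbreviation "rel \<equiv> Rel S \<I> w"
abbreviation heavier :: "'a set \<Rightarrow> real \<Rightarrow> 'a set"
  where "heavier X \<theta> \<equiv> {x \<in> X. \<theta> < w x}"

lemma one_mem: "1 \<in> {1..k}"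
  using k by simp

lemma finite_S: "finite S"
  using matroidD(1)[OF mat[OF one_mem]] .

lemma indep_mem: "A \<in> \<I> \<Longrightarrow> i \<in> {1..k} \<Longrightarrow> A \<in> Is i"
  by (auto simp: common_indep_def)

lemma indep_subset: "A \<in> \<I> \<Longrightarrow> A \<subseteq> S"
  using matroidD(2)[OF mat[OF one_mem]] indep_mem one_mem by blast

lemma indep_empty: "{} \<in> \<I>"
  using matroidD(3)[OF mat] by (auto simp: common_indep_def)

lemma indep_mono: "A \<in> \<I> \<Longrightarrow> B \<subseteq> A \<Longrightarrow> B \<in> \<I>"
  using matroidD(4)[OF mat] by (auto simp: common_indep_def)

lemma clos_mono: "X \<subseteq> Y \<Longrightarrow> clos X \<subseteq> clos Y"
  unfolding Hull_def using span_mono[OF mat] by blast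

lemma insert_indep_if_not_clos: "A \<in> \<I> \<Longrightarrow> x \<in> S \<Longrightarrow> x \<notin> clos A \<Longrightarrow> insert x A \<in> \<I>"
  unfolding Hull_def common_indep_def by (auto intro: insert_indep_if_not_span[OF mat])

lemma set_decreasing_list: "X \<subseteq> S \<Longrightarrow> set (decreasing_list w X) = X"
  using set_sorted_key_list_of_inj[OF inj] finite_subset[OF _ finite_S] by (simp add: decreasing_list_def)

lemma sorted_decreasing_list: "X \<subseteq> S \<Longrightarrow> sorted_wrt (\<lambda>x y. w x > w y) (decreasing_list w X)"
  using sorted_sorted_key_list_of_inj[OF inj] finite_subset[OF _ finite_S]
  by (simp add: decreasing_list_def sorted_wrt_rev)

lemma decreasing_list_insert:
  assumes "insert m X \<subseteq> S" "\<And>x. x \<in> X \<Longrightarrow> w m < w x"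
  shows "decreasing_list w (insert m X) = decreasing_list w X @ [m]"
  using sorted_key_list_of_insert_min[OF inj assms(1)] finite_subset[OF _ finite_S] assms
  by (simp add: decreasing_list_def)

lemma greedy_empty: "greedy {} = {}"
  using set_decreasing_list[of "{}"] by (simp add: Greedy_def)

lemma greedy_insert:
  assumes "insert m X \<subseteq> S" "\<And>x. x \<in> X \<Longrightarrow> w m < w x"
  shows "greedy (insert m X)
    = (if insert m (greedy X) \<in> \<I> then insert m (greedy X) else greedy X)"
proof -
  have "decreasing_list w (insert m X) = decreasing_list w X @ [m]"
    by (rule decreasing_list_insert) (use assms in auto)
  then show ?thesis unfolding Greedy_def by simp
qed

lemma subset_induct_decreasing [consumes 1, case_names empty insert]:
  assumes "X \<subseteq> S" "P {}"
    and "\<And>m X. insert m X \<subseteq> S \<Longrightarrow> (\<And>x. x \<in> X \<Longrightarrow> w m < w x) \<Longrightarrow> P X \<Longrightarrow> P (insert m X)"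
  shows "P X"
proof -
  have "finite X" using assms(1) finite_S finite_subset by blast
  then show ?thesis using assms(1)
  proof (induction X rule: finite_ranking_induct[where f = "\<lambda>x. - w x"])
    case (insert x X)
    show ?case
    proof (cases "x \<in> X")
      case True
      then show ?thesis using insert by (simp add: insert_absorb)
    next
      case False
      have gt: "w x < w y" if "y \<in> X" for y
        using insert(2)[OF that] inj insert.prems that False
        by (metis inj_on_eq_iff insert_subset less_eq_real_def neg_le_iff_le subset_iff)
      then show ?thesis using assms(3) insert by simp
    qed
  qed (rule assms(2))
qed

lemma greedy_subset: "X \<subseteq> S \<Longrightarrow> greedy X \<subseteq> X"
  by (induction X rule: subset_induct_decreasing) (auto simp: greedy_empty greedy_insert)

lemma greedy_indep: "X \<subseteq> S \<Longrightarrow> greedy X \<in> \<I>"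
  by (induction X rule: subset_induct_decreasing) (auto simp: greedy_empty greedy_insert indep_empty)

text \<open>Heavier elements are decided first, so the lighter ones cannot influence them.\<close>

lemma greedy_heavier: "X \<subseteq> S \<Longrightarrow> greedy (heavier X \<theta>) = heavier (greedy X) \<theta>"
proof (induction X rule: subset_induct_decreasing)
  case empty
  then show ?case by (simp add: greedy_empty)
next
  case (insert m X)
  show ?case
  proof (cases "\<theta> < w m")
    case True
    then have "heavier (insert m X) \<theta> = insert m X" using insert(2) by (auto dest: less_trans)
    moreover have "\<theta> < w x" if "x \<in> greedy (insert m X)" for x
      using greedy_subset[OF insert(1)] insert(2)[of x] True that by fastforce
    then have "heavier (greedy (insert m X)) \<theta> = greedy (insert m X)" by blast
    ultimately show ?thesis by simp
  next
    case False
    then have "heavier (insert m X) \<theta> = heavier X \<theta>" by auto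
    moreover have "heavier (greedy (insert m X)) \<theta> = heavier (greedy X) \<theta>"
      using False greedy_insert[OF insert(1,2)] by auto
    ultimately show ?thesis using insert(3) by simp
  qed
qed

text \<open>The greedy test of \<open>f\<close> against \<open>Y\<close>. The strict inequality in
  \<open>heavier\<close> leaves \<open>f\<close> itself out, so the test has the same outcome
  whether or not \<open>f\<close> is in \<open>Y\<close>.\<close>

definition qualifies :: "'a set \<Rightarrow> 'a \<Rightarrow> bool" where
  "qualifies Y f \<longleftrightarrow> insert f (greedy (heavier Y (w f))) \<in> \<I>"

lemma mem_greedy_iff: "X \<subseteq> S \<Longrightarrow> x \<in> greedy X \<longleftrightarrow> x \<in> X \<and> qualifies X x"
proof (induction X rule: subset_induct_decreasing)
  case empty
  then show ?case by (simp add: greedy_empty)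
next
  case (insert m X)
  show ?case
  proof (cases "x = m")
    case True
    have "heavier (insert m X) (w m) = X" using insert(2) by auto
    moreover have "m \<notin> greedy X" using greedy_subset[of X] insert(1,2) by blast
    ultimately show ?thesis using True greedy_insert[OF insert(1,2)] by (auto simp: qualifies_def)
  next
    case False
    have "heavier (insert m X) (w x) = heavier X (w x)" if "x \<in> X" using insert(2)[OF that] by auto
    then show ?thesis using False insert(3) greedy_insert[OF insert(1,2)]
      by (auto simp: qualifies_def)
  qed
qed

lemma heavier_insert_self: "heavier (insert f Y) (w f) = heavier Y (w f)"
  by auto

lemma qualifies_insert_self: "qualifies (insert f Y) f = qualifies Y f"
  by (simp only: qualifies_def heavier_insert_self)

lemma mem_rel_iff: "Y \<subseteq> S \<Longrightarrow> f \<in> rel Y \<longleftrightarrow> f \<in> S - Y \<and> qualifies Y f"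
  using mem_greedy_iff[of "insert f Y" f] by (auto simp: Rel_def qualifies_insert_self)

lemma rel_subset: "rel Y \<subseteq> S - Y"
  by (auto simp: Rel_def)

text \<open>An element heavier than \<open>f\<close> is tested only against elements heavier still,
  so the membership of \<open>f\<close> in \<open>Y\<close> cannot affect it.\<close>

lemma heavier_rel_insert_self:
  assumes "Y \<subseteq> S" "f \<in> S"
  shows "heavier (rel (insert f Y)) (w f) = heavier (rel Y) (w f)"
proof -
  have "g \<in> rel (insert f Y) \<longleftrightarrow> g \<in> rel Y" if "w f < w g" for g
  proof -
    have "heavier (insert f Y) (w g) = heavier Y (w g)" using that by auto
    then have "qualifies (insert f Y) g = qualifies Y g" by (simp only: qualifies_def)
    then show ?thesis using that assms mem_rel_iff[of Y g] mem_rel_iff[of "insert f Y" g] by auto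
  qed
  then show ?thesis by blast
qed

lemma sum_of_bool_weight:
  assumes "A \<subseteq> S" shows "(\<Sum>x\<in>S. of_bool (x \<in> A) * w x) = sum w A"
proof -
  have "(\<Sum>x\<in>S. of_bool (x \<in> A) * w x) = (\<Sum>x\<in>S. if x \<in> A then w x else 0)"
    by (intro sum.cong) auto
  also have "\<dots> = sum w (S \<inter> A)" using finite_S by (simp add: sum.inter_restrict)
  finally show ?thesis using assms by (simp add: Int_absorb1)
qed

lemma sum_of_bool_prefix:
  "(\<Sum>x | x \<in> S \<and> P x. of_bool (Q x)) = real (card {x \<in> S. P x \<and> Q x})"
proof -
  have "(\<Sum>x | x \<in> S \<and> P x. of_bool (Q x)) = (\<Sum>x | x \<in> S \<and> P x. if Q x then 1 else (0::real))"
    by (intro sum.cong) auto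
  also have "\<dots> = (\<Sum>x\<in>{x. x \<in> {x \<in> S. P x} \<and> Q x}. 1)"
    using finite_S by (subst sum.inter_filter) auto
  finally show ?thesis by (simp add: conj_assoc)
qed

text \<open>On each upper level set, an element of \<open>J\<close> that greedy rejects lies in the
  hull of heavier greedy elements. So the \<open>k\<close> spans of the greedy prefix cover the
  prefix of \<open>J\<close>, and each span holds at most as many elements of the independent set
  \<open>J\<close> as the greedy prefix has.\<close>

lemma greedy_approx:
  assumes X: "X \<subseteq> S" and J: "J \<in> \<I>" "J \<subseteq> X"
  shows "sum w J \<le> real k * sum w (greedy X)"
proof -
  have JS: "J \<subseteq> S" using X J by blast
  have GS: "greedy X \<subseteq> S" using greedy_subset[OF X] X by blast
  have main: "card {x \<in> S. c \<le> w x \<and> x \<in> J} \<le> k * card {x \<in> S. c \<le> w x \<and> x \<in> greedy X}" for c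
  proof -
    let ?J = "{x \<in> S. c \<le> w x \<and> x \<in> J}" and ?G = "{x \<in> S. c \<le> w x \<and> x \<in> greedy X}"
    have finG: "finite ?G" using finite_S by simp
    have "?J \<subseteq> clos ?G"
    proof
      fix x assume x: "x \<in> ?J"
      show "x \<in> clos ?G"
      proof (cases "x \<in> greedy X")
        case True
        then have "x \<in> ?G" using x by auto
        then have "insert x ?G = ?G" by blast
        \<comment> \<open>A chosen element is spanned trivially; the matroid of index 1 serves as
          witness.\<close>
        then show ?thesis using one_mem x unfolding Hull_def matroid_span_def by auto
      next
        case False
        then have "\<not> qualifies X x" using mem_greedy_iff[OF X] x J by auto
        then have ni: "insert x (heavier (greedy X) (w x)) \<notin> \<I>"
          by (simp add: qualifies_def greedy_heavier[OF X])
        have "heavier (greedy X) (w x) \<in> \<I>"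
          by (rule indep_mono[OF greedy_indep[OF X]]) auto
        then have "x \<in> clos (heavier (greedy X) (w x))"
          using insert_indep_if_not_clos ni x by blast
        moreover have "heavier (greedy X) (w x) \<subseteq> ?G" using x GS by auto
        ultimately show ?thesis using clos_mono by blast
      qed
    qed
    then have "?J = (\<Union>i\<in>{1..k}. ?J \<inter> matroid_span S (Is i) ?G)" by (auto simp: Hull_def)
    then have "card ?J \<le> (\<Sum>i\<in>{1..k}. card (?J \<inter> matroid_span S (Is i) ?G))"
      using card_UN_le[of "{1..k}" "\<lambda>i. ?J \<inter> matroid_span S (Is i) ?G"] by simp
    also have "\<dots> \<le> (\<Sum>i\<in>{1..k}. card ?G)"
    proof (rule sum_mono)
      fix i assume i: "i \<in> {1..k}"
      have "?J \<inter> matroid_span S (Is i) ?G \<in> Is i"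
        by (rule matroidD(4)[OF mat[OF i] indep_mem[OF J(1) i]]) auto
      from card_le_rank_if_spanned[OF mat[OF i] this Int_lower2]
      show "card (?J \<inter> matroid_span S (Is i) ?G) \<le> card ?G"
        using rank_le_card[OF mat[OF i] finG] by (rule order_trans)
    qed
    finally show ?thesis by simp
  qed
  have "(\<Sum>x\<in>S. of_bool (x \<in> J) * w x) \<le> (\<Sum>x\<in>S. (real k * of_bool (x \<in> greedy X)) * w x)"
  proof (rule weighted_sum_mono[OF finite_S inj nonneg])
    fix y
    show "(\<Sum>x | x \<in> S \<and> w y \<le> w x. of_bool (x \<in> J))
      \<le> (\<Sum>x | x \<in> S \<and> w y \<le> w x. real k * of_bool (x \<in> greedy X))"
      unfolding sum_distrib_left[symmetric] sum_of_bool_prefix of_nat_mult[symmetric] of_nat_le_iff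
      by (rule main)
  qed
  also have "\<dots> = real k * (\<Sum>x\<in>S. of_bool (x \<in> greedy X) * w x)"
    by (simp only: mult.assoc sum_distrib_left)
  finally show ?thesis unfolding sum_of_bool_weight[OF JS] sum_of_bool_weight[OF GS] .
qed

subsection \<open>Expected weight of the relevant elements\<close>

definition prob :: "real \<Rightarrow> ('a set \<Rightarrow> bool) \<Rightarrow> real" where
  "prob p P = (\<Sum>Y\<in>Pow S. bern p S Y * of_bool (P Y))"

lemma expected_weight:
  assumes "\<And>Y. Y \<subseteq> S \<Longrightarrow> A Y \<subseteq> S"
  shows "(\<Sum>x\<in>S. prob p (\<lambda>Y. x \<in> A Y) * w x) = (\<Sum>Y\<in>Pow S. bern p S Y * sum w (A Y))"
proof -
  have "(\<Sum>x\<in>S. prob p (\<lambda>Y. x \<in> A Y) * w x)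
    = (\<Sum>Y\<in>Pow S. \<Sum>x\<in>S. bern p S Y * of_bool (x \<in> A Y) * w x)"
    unfolding prob_def sum_distrib_right by (rule sum.swap)
  also have "\<dots> = (\<Sum>Y\<in>Pow S. bern p S Y * (\<Sum>x\<in>S. of_bool (x \<in> A Y) * w x))"
    by (simp only: sum_distrib_left mult.assoc)
  also have "\<dots> = (\<Sum>Y\<in>Pow S. bern p S Y * sum w (A Y))"
    by (intro sum.cong refl) (simp add: sum_of_bool_weight assms)
  finally show ?thesis .
qed

text \<open>Both memberships amount to \<open>qualifies Y f\<close>, with \<open>f\<close> outside
  \<open>Y\<close> for \<open>rel\<close> and inside for \<open>greedy\<close>, so
  \<open>sum_bern_swap\<close> applies. The event \<open>Q\<close> makes room for the condition of
  being spanned.\<close>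

lemma prob_rel_eq:
  assumes "f \<in> S" and "\<And>Y. Y \<subseteq> S \<Longrightarrow> Q (insert f Y) = Q Y"
  shows "p * prob p (\<lambda>Y. f \<in> rel Y \<and> Q Y) = (1 - p) * prob p (\<lambda>Y. f \<in> greedy Y \<and> Q Y)"
proof -
  have "prob p (\<lambda>Y. f \<in> rel Y \<and> Q Y)
      = (\<Sum>Y\<in>Pow S. bern p S Y * of_bool (f \<notin> Y \<and> qualifies Y f \<and> Q Y))"
    unfolding prob_def by (intro sum.cong refl) (use assms mem_rel_iff in auto)
  moreover have "prob p (\<lambda>Y. f \<in> greedy Y \<and> Q Y)
      = (\<Sum>Y\<in>Pow S. bern p S Y * of_bool (f \<in> Y \<and> qualifies Y f \<and> Q Y))"
    unfolding prob_def by (intro sum.cong refl) (use assms mem_greedy_iff in auto)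
  moreover have "p * (\<Sum>Y\<in>Pow S. bern p S Y * of_bool (f \<notin> Y \<and> qualifies Y f \<and> Q Y))
      = (1 - p) * (\<Sum>Y\<in>Pow S. bern p S Y * of_bool (f \<in> Y \<and> qualifies Y f \<and> Q Y))"
    by (rule sum_bern_swap[OF finite_S assms(1)]) (simp only: qualifies_insert_self assms(2))
  ultimately show ?thesis by simp
qed

text \<open>The sample keeps weight \<open>p * sum w J\<close> of \<open>J\<close> on average, and
  \<open>J \<inter> Y\<close> is a competitor of \<open>greedy Y\<close>, which is a
  \<open>k\<close>-approximation inside \<open>Y\<close>.\<close>

lemma expected_rel_weight:
  assumes p: "0 < p" "p \<le> 1" and J: "J \<in> \<I>"
  shows "(1 - p) * sum w J \<le> real k * (\<Sum>x\<in>S. prob p (\<lambda>Y. x \<in> rel Y) * w x)"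
proof -
  have JS: "J \<subseteq> S" using indep_subset[OF J] .
  have "p * sum w J = (\<Sum>x\<in>S. of_bool (x \<in> J) * w x * p)"
    by (simp add: sum_of_bool_weight[OF JS] flip: sum_distrib_right)
  also have "\<dots> = (\<Sum>x\<in>S. of_bool (x \<in> J) * w x * prob p (\<lambda>Y. x \<in> Y))"
    by (intro sum.cong refl) (simp add: prob_def sum_bern_mem[OF finite_S])
  also have "\<dots> = (\<Sum>x\<in>S. prob p (\<lambda>Y. x \<in> J \<inter> Y) * w x)"
    by (intro sum.cong refl) (simp add: prob_def of_bool_conj)
  also have "\<dots> = (\<Sum>Y\<in>Pow S. bern p S Y * sum w (J \<inter> Y))"
    by (rule expected_weight) (use JS in auto)
  also have "\<dots> \<le> (\<Sum>Y\<in>Pow S. bern p S Y * (real k * sum w (greedy Y)))"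
    by (intro sum_mono mult_left_mono greedy_approx bern_nonneg)
      (use p in \<open>auto intro: indep_mono[OF J]\<close>)
  also have "\<dots> = real k * (\<Sum>Y\<in>Pow S. bern p S Y * sum w (greedy Y))"
    by (simp add: sum_distrib_left algebra_simps)
  also have "\<dots> = real k * (\<Sum>x\<in>S. prob p (\<lambda>Y. x \<in> greedy Y) * w x)"
    by (subst expected_weight) (use greedy_subset in blast)+
  \<comment> \<open>The factor \<open>1 - p\<close> prepares the exchange of \<open>greedy\<close>
    for \<open>rel\<close>, which produces a factor \<open>p\<close> on the right; the two factors
    \<open>p\<close> then cancel.\<close>
  finally have "(1 - p) * (p * sum w J)
      \<le> (1 - p) * (real k * (\<Sum>x\<in>S. prob p (\<lambda>Y. x \<in> greedy Y) * w x))"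
    using p by (intro mult_left_mono) auto
  also have "\<dots> = real k * (\<Sum>x\<in>S. ((1 - p) * prob p (\<lambda>Y. x \<in> greedy Y)) * w x)"
    by (simp only: mult.assoc mult.left_commute[of "1 - p" "real k"] sum_distrib_left)
  also have "(\<Sum>x\<in>S. ((1 - p) * prob p (\<lambda>Y. x \<in> greedy Y)) * w x)
      = (\<Sum>x\<in>S. (p * prob p (\<lambda>Y. x \<in> rel Y)) * w x)"
    by (intro sum.cong refl) (use prob_rel_eq[where Q = "\<lambda>_. True"] in simp)
  also have "real k * \<dots> = p * (real k * (\<Sum>x\<in>S. prob p (\<lambda>Y. x \<in> rel Y) * w x))"
    by (simp only: mult.assoc mult.left_commute[of p "real k"] sum_distrib_left)
  finally show ?thesis using p by (simp add: mult.left_commute)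
qed

section \<open>The loss from spanned elements\<close>

text \<open>Let \<open>X\<close> be the prefix of \<open>rel Y\<close>. The spanned greedy elements
  are independent inside the span of \<open>X\<close>, so they number at most its rank; the spanned
  elements of \<open>X\<close> number at most \<open>card X\<close> minus that rank.\<close>

lemma card_spanned_le:
  assumes Y: "Y \<subseteq> S" and i: "i \<in> {1..k}"
  defines "sp x \<equiv> x \<in> matroid_span S (Is i) (heavier (rel Y) (w x))"
  shows "card {x \<in> S. c \<le> w x \<and> x \<in> greedy Y \<and> sp x} + card {x \<in> S. c \<le> w x \<and> x \<in> rel Y \<and> sp x}
    \<le> card {x \<in> S. c \<le> w x \<and> x \<in> rel Y}"
proof -
  let ?X = "{x \<in> S. c \<le> w x \<and> x \<in> rel Y}" and ?G = "{x \<in> S. c \<le> w x \<and> x \<in> greedy Y \<and> sp x}"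
  have hv: "heavier (rel Y) (w x) = heavier ?X (w x)" if "c \<le> w x" for x
    using that rel_subset[of Y] by auto
  have "?G \<in> Is i"
    by (rule matroidD(4)[OF mat[OF i] indep_mem[OF greedy_indep[OF Y] i]]) auto
  moreover have "?G \<subseteq> matroid_span S (Is i) ?X"
  proof
    fix x assume x: "x \<in> ?G"
    then have "x \<in> matroid_span S (Is i) (heavier (rel Y) (w x))" by (simp add: sp_def)
    then have "x \<in> matroid_span S (Is i) (heavier ?X (w x))" using hv[of x] x by simp
    then show "x \<in> matroid_span S (Is i) ?X"
      using span_mono[OF mat[OF i], of "heavier ?X (w x)" ?X] by blast
  qed
  ultimately have "card ?G \<le> matroid_rank (Is i) ?X"
    using card_le_rank_if_spanned[OF mat[OF i]] by blast
  moreover have eq: "{x \<in> S. c \<le> w x \<and> x \<in> rel Y \<and> sp x}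
      = {f \<in> ?X. f \<in> matroid_span S (Is i) (heavier ?X (w f))}"
    using hv by (auto simp: sp_def)
  moreover have "matroid_rank (Is i) ?X + card {f \<in> ?X. f \<in> matroid_span S (Is i) (heavier ?X (w f))}
      \<le> card ?X"
    by (rule rank_add_spanned_le_card[OF mat[OF i] _ _ inj]) (use finite_S in auto)
  ultimately show ?thesis unfolding eq by linarith
qed

lemma prob_prefix:
  "(\<Sum>x | x \<in> S \<and> c \<le> w x. prob p (\<lambda>Y. Q x Y))
    = (\<Sum>Y\<in>Pow S. bern p S Y * real (card {x \<in> S. c \<le> w x \<and> Q x Y}))"
proof -
  have "(\<Sum>x | x \<in> S \<and> c \<le> w x. prob p (\<lambda>Y. Q x Y))
      = (\<Sum>Y\<in>Pow S. \<Sum>x | x \<in> S \<and> c \<le> w x. bern p S Y * of_bool (Q x Y))"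
    unfolding prob_def by (rule sum.swap)
  then show ?thesis by (simp only: sum_distrib_left[symmetric] sum_of_bool_prefix)
qed

text \<open>
  Whether \<open>f\<close> is spanned by the heavier elements of \<open>rel Y\<close> does not depend on \<open>f \<in> Y\<close>, so the
  spanned elements of \<open>rel Y\<close> and of \<open>greedy Y\<close> occur in the ratio \<open>(1 - p) : p\<close>, while their total
  number in each prefix is at most that of \<open>rel Y\<close>.
\<close>

lemma expected_spanned_weight:
  assumes p: "0 \<le> p" "p \<le> 1" and i: "i \<in> {1..k}"
  defines "sp x Y \<equiv> x \<in> matroid_span S (Is i) (heavier (rel Y) (w x))"
  shows "(\<Sum>x\<in>S. prob p (\<lambda>Y. x \<in> rel Y \<and> sp x Y) * w x)
    \<le> (\<Sum>x\<in>S. ((1 - p) * prob p (\<lambda>Y. x \<in> rel Y)) * w x)"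
proof (rule weighted_sum_mono[OF finite_S inj nonneg])
  fix y
  let ?A = "{x. x \<in> S \<and> w y \<le> w x}"
  let ?g = "\<Sum>x\<in>?A. prob p (\<lambda>Y. x \<in> greedy Y \<and> sp x Y)"
  let ?r = "\<Sum>x\<in>?A. prob p (\<lambda>Y. x \<in> rel Y \<and> sp x Y)"
  have "?g + ?r \<le> (\<Sum>x\<in>?A. prob p (\<lambda>Y. x \<in> rel Y))"
    unfolding prob_prefix sum.distrib[symmetric] distrib_left[symmetric] of_nat_add[symmetric]
    by (intro sum_mono mult_left_mono bern_nonneg p of_nat_mono)
      (unfold sp_def, use card_spanned_le[OF _ i] in auto)
  then have "(1 - p) * (?g + ?r) \<le> (1 - p) * (\<Sum>x\<in>?A. prob p (\<lambda>Y. x \<in> rel Y))"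
    using p by (intro mult_left_mono) auto
  \<comment> \<open>Hence \<open>(1 - p) * (?g + ?r)\<close> equals
    \<open>p * ?r + (1 - p) * ?r\<close>, which is \<open>?r\<close>.\<close>
  moreover have "p * ?r = (1 - p) * ?g"
    unfolding sum_distrib_left
    by (intro sum.cong refl prob_rel_eq) (simp_all only: sp_def heavier_rel_insert_self, auto simp: heavier_rel_insert_self)
  ultimately show "?r \<le> (\<Sum>x\<in>?A. (1 - p) * prob p (\<lambda>Y. x \<in> rel Y))"
    unfolding sum_distrib_left[symmetric] by (simp add: algebra_simps)
qed

text \<open>Union bound: a relevant element in the hull is spanned in one of the \<open>k\<close>
  matroids, and each matroid costs at most a fraction \<open>1 - p\<close> of the weight.\<close>

lemma expected_unspanned_weight:
  assumes p: "0 \<le> p" "p \<le> 1"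
  shows "(1 - real k * (1 - p)) * (\<Sum>x\<in>S. prob p (\<lambda>Y. x \<in> rel Y) * w x)
    \<le> (\<Sum>x\<in>S. prob p (\<lambda>Y. x \<in> rel Y \<and> x \<notin> clos (heavier (rel Y) (w x))) * w x)"
proof -
  let ?R = "\<Sum>x\<in>S. prob p (\<lambda>Y. x \<in> rel Y) * w x"
  let ?sp = "\<lambda>i x Y. x \<in> matroid_span S (Is i) (heavier (rel Y) (w x))"
  have union: "prob p (\<lambda>Y. x \<in> rel Y) \<le> prob p (\<lambda>Y. x \<in> rel Y \<and> x \<notin> clos (heavier (rel Y) (w x)))
      + (\<Sum>i\<in>{1..k}. prob p (\<lambda>Y. x \<in> rel Y \<and> ?sp i x Y))" for x
  proof -
    have "of_bool (x \<in> rel Y) \<le> (of_bool (x \<in> rel Y \<and> x \<notin> clos (heavier (rel Y) (w x))) :: real)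
      + (\<Sum>i\<in>{1..k}. of_bool (x \<in> rel Y \<and> ?sp i x Y))" for Y
    proof (cases "x \<in> rel Y \<and> x \<in> clos (heavier (rel Y) (w x))")
      case True
      then obtain i where i: "i \<in> {1..k}" "?sp i x Y" by (auto simp: Hull_def)
      then have "of_bool (x \<in> rel Y \<and> ?sp i x Y) \<le> (\<Sum>i\<in>{1..k}. of_bool (x \<in> rel Y \<and> ?sp i x Y) :: real)"
        by (intro member_le_sum) auto
      then show ?thesis using True i by simp
    next
      case False
      have "0 \<le> (\<Sum>i\<in>{1..k}. of_bool (x \<in> rel Y \<and> ?sp i x Y) :: real)" by (intro sum_nonneg) auto
      then show ?thesis using False by auto
    qed
    then have "prob p (\<lambda>Y. x \<in> rel Y)
      \<le> (\<Sum>Y\<in>Pow S. bern p S Y * (of_bool (x \<in> rel Y \<and> x \<notin> clos (heavier (rel Y) (w x)))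
        + (\<Sum>i\<in>{1..k}. of_bool (x \<in> rel Y \<and> ?sp i x Y))))"
      unfolding prob_def by (intro sum_mono mult_left_mono bern_nonneg p)
    also have "\<dots> = prob p (\<lambda>Y. x \<in> rel Y \<and> x \<notin> clos (heavier (rel Y) (w x)))
      + (\<Sum>Y\<in>Pow S. \<Sum>i\<in>{1..k}. bern p S Y * of_bool (x \<in> rel Y \<and> ?sp i x Y))"
      by (simp only: prob_def distrib_left sum.distrib sum_distrib_left)
    also have "(\<Sum>Y\<in>Pow S. \<Sum>i\<in>{1..k}. bern p S Y * of_bool (x \<in> rel Y \<and> ?sp i x Y))
      = (\<Sum>i\<in>{1..k}. prob p (\<lambda>Y. x \<in> rel Y \<and> ?sp i x Y))"
      unfolding prob_def by (rule sum.swap)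
    finally show ?thesis .
  qed
  have "?R \<le> (\<Sum>x\<in>S. (prob p (\<lambda>Y. x \<in> rel Y \<and> x \<notin> clos (heavier (rel Y) (w x)))
      + (\<Sum>i\<in>{1..k}. prob p (\<lambda>Y. x \<in> rel Y \<and> ?sp i x Y))) * w x)"
    by (intro sum_mono mult_right_mono union nonneg)
  also have "\<dots> = (\<Sum>x\<in>S. prob p (\<lambda>Y. x \<in> rel Y \<and> x \<notin> clos (heavier (rel Y) (w x))) * w x)
      + (\<Sum>x\<in>S. \<Sum>i\<in>{1..k}. prob p (\<lambda>Y. x \<in> rel Y \<and> ?sp i x Y) * w x)"
    by (simp only: distrib_right sum.distrib sum_distrib_right)
  also have "(\<Sum>x\<in>S. \<Sum>i\<in>{1..k}. prob p (\<lambda>Y. x \<in> rel Y \<and> ?sp i x Y) * w x)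
      = (\<Sum>i\<in>{1..k}. \<Sum>x\<in>S. prob p (\<lambda>Y. x \<in> rel Y \<and> ?sp i x Y) * w x)"
    by (rule sum.swap)
  also have "\<dots> \<le> (\<Sum>i\<in>{1..k}. (1 - p) * ?R)"
  proof (rule sum_mono)
    fix i assume "i \<in> {1..k}"
    from expected_spanned_weight[OF p this]
    show "(\<Sum>x\<in>S. prob p (\<lambda>Y. x \<in> rel Y \<and> ?sp i x Y) * w x) \<le> (1 - p) * ?R"
      by (simp only: mult.assoc sum_distrib_left)
  qed
  finally show ?thesis by (simp add: algebra_simps)
qed

subsection \<open>The run of the algorithm\<close>

lemma fold_reveal_indep: "A \<in> \<I> \<Longrightarrow> fold (reveal \<I> ok) fs A \<in> \<I>"
  by (induction fs arbitrary: A) (auto simp: reveal_def)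

lemma fold_reveal_bounds:
  "A \<subseteq> fold (reveal \<I> ok) fs A \<and> fold (reveal \<I> ok) fs A \<subseteq> A \<union> {f \<in> set fs. ok f}"
proof (induction fs arbitrary: A)
  case (Cons f fs)
  show ?case using Cons.IH[of "reveal \<I> ok f A"] by (auto simp: reveal_def)
qed simp

text \<open>Makes the arbitrary order harmless: whatever precedes \<open>f\<close>, the current set
  is independent and consists of \<open>A\<close> and eligible elements other than \<open>f\<close>.
  The last assumption covers all such sets.\<close>

lemma fold_reveal_accepts:
  assumes "f \<in> set fs" "ok f" "A \<in> \<I>"
    and "\<And>B. B \<in> \<I> \<Longrightarrow> B \<subseteq> A \<union> {g \<in> set fs. ok g \<and> g \<noteq> f} \<Longrightarrow> insert f B \<in> \<I>"
  shows "f \<in> fold (reveal \<I> ok) fs A"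
proof -
  obtain xs ys where fs: "fs = xs @ f # ys" "f \<notin> set xs" using split_list_first[OF assms(1)] by blast
  let ?B = "fold (reveal \<I> ok) xs A"
  have "insert f ?B \<in> \<I>"
    using fold_reveal_bounds[of A ok xs] fs by (intro assms(4) fold_reveal_indep assms(3)) auto
  then have "reveal \<I> ok f ?B = insert f ?B" using assms(2) by (simp add: reveal_def)
  then show ?thesis using fold_reveal_bounds[of "insert f ?B" ok ys] fs by auto
qed

lemma fos_state_sound:
  assumes "fos_state S k Is w Y S1 S2 j U A"
  shows "A \<in> \<I> \<and> U \<subseteq> S2 \<and> A \<subseteq> rel Y \<inter> S2"
  using assms
proof (induction rule: fos_state.induct)
  case init
  then show ?case by (simp add: indep_empty)
next
  case (round j U A es Q fs A')
  let ?ok = "\<lambda>f. f \<in> rel Y \<and> w (es ! j) < w f"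
  show ?case using round fold_reveal_indep[of A ?ok fs] fold_reveal_bounds[of A ?ok fs] by auto
qed

lemma fos_result_indep:
  assumes "fos_result S k Is w Y S1 S2 ALG"
  shows "ALG \<in> \<I>"
  using assms fos_state_sound fold_reveal_indep unfolding fos_result_def by blast

section \<open>Comparing the two halves, and acceptance\<close>

text \<open>As the threshold falls and top segments grow, \<open>f\<close> enters the hull of
  \<open>A\<close> no later than that of \<open>B\<close>. A threshold below all weights compares
  the whole sets.\<close>

definition dominates :: "'a \<Rightarrow> 'a set \<Rightarrow> 'a set \<Rightarrow> bool" where
  "dominates f A B \<longleftrightarrow> (\<forall>\<theta>. f \<in> clos (heavier B \<theta>) \<longrightarrow> f \<in> clos (heavier A \<theta>))"

text \<open>The thresholds at which \<open>f\<close> lies in the hull form a downward closed set of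
  reals, and two such sets are comparable by inclusion.\<close>

lemma dominates_total: "dominates f A B \<or> dominates f B A"
proof (rule ccontr)
  assume "\<not> ?thesis"
  then obtain \<theta> \<eta> where *: "f \<in> clos (heavier B \<theta>)" "f \<notin> clos (heavier A \<theta>)"
    "f \<in> clos (heavier A \<eta>)" "f \<notin> clos (heavier B \<eta>)" unfolding dominates_def by blast
  have mono: "clos (heavier X a) \<subseteq> clos (heavier X b)" if "b \<le> a" for X a b
    using that by (intro clos_mono) auto
  show False using * mono[of \<theta> \<eta> A] mono[of \<eta> \<theta> B] by (cases "\<theta> \<le> \<eta>") auto
qed

text \<open>When \<open>f\<close> is revealed, no earlier top segment of
  \<open>rel Y \<inter> S1\<close> has it in its hull. By dominance neither has the corresponding
  segment of \<open>rel Y \<inter> S2 - {f}\<close>, which contains everything accepted so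
  far.\<close>

lemma accepted:
  assumes disj: "S1 \<inter> S2 = {}"
    and f: "f \<in> rel Y" "f \<in> S2" "f \<notin> clos (heavier (rel Y) (w f))"
    and dom: "dominates f (rel Y \<inter> S1) (rel Y \<inter> S2 - {f})"
    and res: "fos_result S k Is w Y S1 S2 ALG"
  shows "f \<in> ALG"
proof -
  define es where "es = fos_thresholds S k Is w Y S1"
  have RS: "rel Y \<subseteq> S" using rel_subset[of Y] by blast
  have RS1: "rel Y \<inter> S1 \<subseteq> S" using RS by blast
  have fS: "f \<in> S" using f RS by blast
  have set_es: "set es = rel Y \<inter> S1"
    using set_decreasing_list[OF RS1] by (simp add: es_def fos_thresholds_def)
  have sorted_es: "w (es ! b) < w (es ! a)" if "a < b" "b < length es" for a b
    using sorted_decreasing_list[OF RS1] that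
    by (simp add: es_def fos_thresholds_def sorted_wrt_iff_nth_less)
  \<comment> \<open>Until it is accepted, \<open>f\<close> is unseen and outside the hull of the
    thresholds used so far, and each accepted element is heavier than one of them.\<close>
  have inv: "f \<in> A \<or> f \<in> U \<and> f \<notin> clos (set (take j es)) \<and> (\<forall>g\<in>A. \<exists>i<j. w (es ! i) < w g)"
    if "fos_state S k Is w Y S1 S2 j U A" for j U A
    using that
  proof (induction rule: fos_state.induct)
    case init
    have "f \<notin> clos {}" using f(3) clos_mono[of "{}" "heavier (rel Y) (w f)"] by blast
    then show ?case using f by simp
  next
    case (round j U A es' Q fs A')
    have es': "es' = es" using round by (simp add: es_def)
    note j = \<open>j < length es'\<close>[unfolded es']
    let ?ok = "\<lambda>f. f \<in> rel Y \<and> w (es ! j) < w f"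
    have A': "A' = fold (reveal \<I> ?ok) fs A" using round es' by blast
    have sound: "A \<in> \<I>" "A \<subseteq> rel Y \<inter> S2" "U \<subseteq> S2" using fos_state_sound[OF round(1)] by auto
    show ?case
    proof (cases "f \<in> A")
      case True
      then show ?thesis using fold_reveal_bounds[of A ?ok fs] A' by blast
    next
      case False
      then have IH: "f \<in> U" "f \<notin> clos (set (take j es))" "\<And>g. g \<in> A \<Longrightarrow> \<exists>i<j. w (es ! i) < w g"
        using round.IH by auto
      have A_heavy: "w (es ! j) < w g" if "g \<in> A" for g
        using IH(3)[OF that] sorted_es[OF _ j] by (meson less_trans)
      show ?thesis
      proof (cases "f \<in> Q")
        case fQ: True
        have "f \<in> fold (reveal \<I> ?ok) fs A"
        proof (rule fold_reveal_accepts)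
          show "f \<in> set fs" using fQ round by simp
          show "A \<in> \<I>" by (rule sound)
          \<comment> \<open>Otherwise the first \<open>j + 1\<close> thresholds would all be heavier
            than \<open>f\<close> (strictly, as \<open>S1\<close> and \<open>S2\<close> are disjoint
            and \<open>w\<close> is injective), and \<open>f\<close>, being in their hull, would be
            spanned.\<close>
          show "?ok f"
          proof (rule ccontr)
            assume "\<not> ?ok f"
            then have le: "w f \<le> w (es ! j)" using f by simp
            have "set (take (Suc j) es) \<subseteq> heavier (rel Y) (w f)"
            proof
              fix e assume e: "e \<in> set (take (Suc j) es)"
              then obtain a where a: "a \<le> j" "e = es ! a" using j by (auto simp: in_set_conv_nth less_Suc_eq_le)
              then have "w (es ! j) \<le> w e" using sorted_es[of a j] j by (cases "a = j") (auto simp: less_imp_le)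
              moreover have eR: "e \<in> rel Y \<inter> S1" using e set_es set_take_subset by fastforce
              moreover have "w e \<noteq> w f" using eR f disj inj fS RS by (auto dest!: inj_onD)
              ultimately show "e \<in> heavier (rel Y) (w f)" using le by auto
            qed
            moreover have "f \<in> clos (set (take (Suc j) es))" using fQ round es' by blast
            ultimately show False using f(3) clos_mono by blast
          qed
          fix B assume B: "B \<in> \<I>" "B \<subseteq> A \<union> {g \<in> set fs. ?ok g \<and> g \<noteq> f}"
          have "set fs \<subseteq> S2" using round sound by auto
          then have "B \<subseteq> heavier (rel Y \<inter> S2 - {f}) (w (es ! j))"
            using B(2) A_heavy sound False by auto
          \<comment> \<open>The strict inequality excludes \<open>es ! j\<close> itself. Only the
            first \<open>j\<close> thresholds remain, and the invariant keeps \<open>f\<close> out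
            of their hull.\<close>
          moreover have "heavier (rel Y \<inter> S1) (w (es ! j)) \<subseteq> set (take j es)"
          proof
            fix e assume e: "e \<in> heavier (rel Y \<inter> S1) (w (es ! j))"
            then have "e \<in> set es" using set_es by simp
            then obtain a where a: "a < length es" "e = es ! a" by (auto simp: in_set_conv_nth)
            then have "a < j" using sorted_es[of j a] e by (cases a j rule: linorder_cases) auto
            then show "e \<in> set (take j es)" using a by (auto simp: in_set_conv_nth)
          qed
          ultimately have "f \<notin> clos B" using dom IH(2) clos_mono unfolding dominates_def by blast
          then show "insert f B \<in> \<I>" using insert_indep_if_not_clos B fS by blast
        qed
        then show ?thesis using A' by simp
      next
        case fQ: False
        then have "f \<notin> clos (set (take (Suc j) es))" using IH round es' by blast
        moreover have "\<exists>i<Suc j. w (es ! i) < w g" if "g \<in> A'" for g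
          using that A_heavy fold_reveal_bounds[of A ?ok fs] A' by blast
        ultimately show ?thesis using fQ IH by blast
      qed
    qed
  qed
  obtain U A fs where st: "fos_state S k Is w Y S1 S2 (length es) U A" and fs: "set fs = U"
    and ALG: "ALG = fold (reveal \<I> (\<lambda>f. f \<in> rel Y)) fs A"
    using res unfolding fos_result_def es_def by blast
  have sound: "A \<in> \<I>" "A \<subseteq> rel Y \<inter> S2" "U \<subseteq> S2" using fos_state_sound[OF st] by auto
  show ?thesis
  proof (cases "f \<in> A")
    case True
    then show ?thesis using fold_reveal_bounds[of A "\<lambda>f. f \<in> rel Y" fs] ALG by blast
  next
    case False
    then have fU: "f \<in> U" "f \<notin> clos (rel Y \<inter> S1)" using inv[OF st] set_es by auto
    show ?thesis unfolding ALG
    proof (rule fold_reveal_accepts)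
      show "f \<in> set fs" "f \<in> rel Y" "A \<in> \<I>" using fU fs f sound by auto
      fix B assume B: "B \<in> \<I>" "B \<subseteq> A \<union> {g \<in> set fs. g \<in> rel Y \<and> g \<noteq> f}"
      \<comment> \<open>No weight is negative, so the threshold -1 applies dominance to the whole
        sets.\<close>
      have all: "heavier X (-1) = X" if "X \<subseteq> rel Y" for X
        using that RS nonneg by (force dest: subsetD)
      have "B \<subseteq> rel Y \<inter> S2 - {f}" using B(2) sound False fs by auto
      moreover have "f \<notin> clos (rel Y \<inter> S2 - {f})"
      proof -
        have "f \<notin> clos (heavier (rel Y \<inter> S1) (-1))" using fU(2) by (subst all) auto
        then have "f \<notin> clos (heavier (rel Y \<inter> S2 - {f}) (-1))"
          using dom unfolding dominates_def by blast
        then show ?thesis by (subst (asm) all) auto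
      qed
      ultimately have "f \<notin> clos B" using clos_mono by blast
      then show "insert f B \<in> \<I>" using insert_indep_if_not_clos B fS by blast
    qed
  qed
qed

text \<open>With \<open>Z\<close> in the role of \<open>S2\<close>: half of the splits have
  \<open>f\<close> in \<open>Z\<close>. Among these, complementing within \<open>T - {f}\<close>
  swaps the two sides, so by totality at least one of each complementary pair is good.\<close>

lemma card_dominated_splits:
  assumes "finite T" "f \<in> T"
  shows "2 ^ card T \<le> 4 * card {Z \<in> Pow T. f \<in> Z \<and> dominates f (R \<inter> (T - Z)) (R \<inter> Z - {f})}"
    (is "_ \<le> 4 * card ?M")
proof -
  define T0 where "T0 = T - {f}"
  have T: "finite T0" "f \<notin> T0" "T = insert f T0" using assms by (auto simp: T0_def)
  define N where "N = {Z \<in> Pow T0. dominates f (R \<inter> (T0 - Z)) (R \<inter> Z)}"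
  have fin: "finite N" "finite ?M" using T by (auto simp: N_def)
  have "Pow T0 \<subseteq> N \<union> (\<lambda>Z. T0 - Z) ` N"
  proof
    fix Z assume Z: "Z \<in> Pow T0"
    then have dd: "T0 - (T0 - Z) = Z" by blast
    show "Z \<in> N \<union> (\<lambda>Z. T0 - Z) ` N"
    proof (cases "dominates f (R \<inter> (T0 - Z)) (R \<inter> Z)")
      case True
      then show ?thesis using Z by (simp add: N_def)
    next
      case False
      then have "T0 - Z \<in> N" using Z dominates_total dd unfolding N_def by auto
      then have "T0 - (T0 - Z) \<in> (\<lambda>Z. T0 - Z) ` N" by (rule imageI)
      then show ?thesis unfolding dd by blast
    qed
  qed
  then have "card (Pow T0) \<le> card (N \<union> (\<lambda>Z. T0 - Z) ` N)" using fin by (intro card_mono) auto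
  also have "\<dots> \<le> card N + card N"
    by (rule order_trans[OF card_Un_le]) (simp add: card_image_le[OF fin(1)])
  finally have "2 ^ card T0 \<le> 2 * card N" using T by (simp add: card_Pow)
  moreover have "card N \<le> card ?M"
  proof (rule card_inj_on_le[of "insert f"])
    show "inj_on (insert f) N" using T by (auto simp: inj_on_def N_def insert_ident)
    show "insert f ` N \<subseteq> ?M"
    proof
      fix W assume "W \<in> insert f ` N"
      then obtain Z where Z: "W = insert f Z" "Z \<in> N" by blast
      then have "R \<inter> (T - W) = R \<inter> (T0 - Z)" "R \<inter> W - {f} = R \<inter> Z" "W \<in> Pow T" "f \<in> W"
        using T by (auto simp: N_def)
      then show "W \<in> ?M" using Z by (simp add: N_def)
    qed
  qed (rule fin)
  ultimately show ?thesis using T by simp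
qed

end

subsection \<open>The arrival times\<close>

text \<open>The arrival times that produce the split into \<open>Y\<close>, \<open>S2 = Z\<close>
  and \<open>S1\<close> the rest. It is a box, so its measure is a product.\<close>

definition cell :: "'a set \<Rightarrow> real \<Rightarrow> 'a set \<times> 'a set \<Rightarrow> ('a \<Rightarrow> real) set" where
  "cell S p = (\<lambda>(Y, Z). \<Pi>\<^sub>E e\<in>S. if e \<in> Y then {0<..<p}
     else if e \<in> Z then {(1 + p) / 2..<1} else {p..<(1 + p) / 2})"

lemma prob_space_unit: "prob_space (uniform_measure lborel {0<..<1::real})"
  by (rule prob_space_uniform_measure) auto

lemma sets_cell: "finite S \<Longrightarrow> cell S p YZ \<in> sets (arrival_times S)"
  unfolding arrival_times_def cell_def by (cases YZ) (auto intro!: sets_PiM_I_finite)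

text \<open>The intervals for \<open>S1\<close> and \<open>S2\<close> both have length
  \<open>(1 - p) / 2\<close>, so given \<open>Y\<close> all splits of the rest are equally
  likely.\<close>

lemma measure_cell:
  assumes S: "finite S" and p: "0 < p" "p < 1" and Y: "Y \<subseteq> S"
  shows "measure (arrival_times S) (cell S p (Y, Z)) = bern p S Y / 2 ^ card (S - Y)"
proof -
  let ?U = "uniform_measure lborel {0<..<1::real}"
  interpret finite_product_prob_space "\<lambda>_. ?U" S
    using prob_space_unit S
    by (simp add: finite_product_prob_space_def finite_product_sigma_finite_def
        finite_product_sigma_finite_axioms_def product_prob_space_def product_prob_space_axioms_def
        product_sigma_finite_def prob_space_imp_sigma_finite)
  have U: "measure ?U {a..<b} = b - a" "measure ?U {0<..<b} = b"
    if "0 < a" "a \<le> b" "b \<le> 1" for a b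
  proof -
    have "{0<..<1} \<inter> {a..<b} = {a..<b}" "{0<..<1} \<inter> {0<..<b} = {0<..<b}" using that by auto
    then show "measure ?U {a..<b} = b - a" "measure ?U {0<..<b} = b" using that by simp_all
  qed
  have "measure (arrival_times S) (cell S p (Y, Z))
    = (\<Prod>e\<in>S. measure ?U (if e \<in> Y then {0<..<p}
       else if e \<in> Z then {(1 + p) / 2..<1} else {p..<(1 + p) / 2}))"
    unfolding arrival_times_def cell_def prod.case by (rule finite_measure_PiM_emb) auto
  also have "\<dots> = (\<Prod>e\<in>S. if e \<in> Y then p else (1 - p) / 2)"
  proof (rule prod.cong[OF refl])
    fix e
    show "measure ?U (if e \<in> Y then {0<..<p}
       else if e \<in> Z then {(1 + p) / 2..<1} else {p..<(1 + p) / 2}) = (if e \<in> Y then p else (1 - p) / 2)"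
      using p U(1)[of "(1 + p) / 2" 1] U(1)[of p "(1 + p) / 2"] U(2)[of p p]
      by (simp add: field_simps)
  qed
  also have "\<dots> = p ^ card Y * ((1 - p) / 2) ^ card (S - Y)"
  proof -
    have "S \<inter> {e. e \<in> Y} = Y" "S \<inter> - {e. e \<in> Y} = S - Y" using Y by auto
    then show ?thesis using S by (simp add: prod.If_cases)
  qed
  finally show ?thesis by (simp add: bern_def power_divide)
qed

lemma mem_cell_iff:
  assumes p: "0 < p" "p < 1" and t: "t \<in> S \<rightarrow>\<^sub>E {0<..<1}" and YZ: "Y \<subseteq> S" "Z \<subseteq> S - Y"
  shows "t \<in> cell S p (Y, Z) \<longleftrightarrow>
    Y = {e \<in> S. t e \<in> {0<..<p}} \<and> Z = {e \<in> S. t e \<in> {(1 + p) / 2..<1}}"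
proof -
  have t01: "0 < t e" "t e < 1" if "e \<in> S" for e using t that by (auto simp: PiE_iff)
  have "t \<in> cell S p (Y, Z) \<longleftrightarrow> (\<forall>e\<in>S. t e \<in> (if e \<in> Y then {0<..<p}
     else if e \<in> Z then {(1 + p) / 2..<1} else {p..<(1 + p) / 2}))"
    using t by (simp add: cell_def PiE_iff)
  also have "\<dots> \<longleftrightarrow> (\<forall>e\<in>S. (e \<in> Y \<longleftrightarrow> t e < p) \<and> (e \<in> Z \<longleftrightarrow> (1 + p) / 2 \<le> t e))"
  proof (rule ball_cong[OF refl])
    fix e assume "e \<in> S"
    then show "t e \<in> (if e \<in> Y then {0<..<p}
       else if e \<in> Z then {(1 + p) / 2..<1} else {p..<(1 + p) / 2})
      \<longleftrightarrow> (e \<in> Y \<longleftrightarrow> t e < p) \<and> (e \<in> Z \<longleftrightarrow> (1 + p) / 2 \<le> t e)"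
      using t01[of e] p YZ by (auto simp: field_simps)
  qed
  also have "\<dots> \<longleftrightarrow> Y = {e \<in> S. t e \<in> {0<..<p}} \<and> Z = {e \<in> S. t e \<in> {(1 + p) / 2..<1}}"
    using YZ t01 by auto
  finally show ?thesis .
qed

text \<open>The returned set may depend on \<open>t\<close> beyond the split, through the arbitrary
  orders, so \<open>g\<close> need not be constant on cells. It is bounded below almost everywhere
  by a simple function that is; \<open>C\<close> serves integrability.\<close>

lemma integral_arrival_times_ge:
  fixes H :: "'a set \<Rightarrow> 'a set \<Rightarrow> real"
  assumes S: "finite S" and p: "0 < p" "p < 1"
    and g: "g \<in> borel_measurable (arrival_times S)"
    and H: "\<And>Y Z. 0 \<le> H Y Z"
    and ge: "\<And>t. t \<in> S \<rightarrow>\<^sub>E {0<..<1}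
      \<Longrightarrow> H {e \<in> S. t e \<in> {0<..<p}} {e \<in> S. t e \<in> {(1 + p) / 2..<1}} \<le> g t"
    and le: "\<And>t. t \<in> S \<rightarrow>\<^sub>E {0<..<1} \<Longrightarrow> g t \<le> C"
  shows "(\<Sum>Y\<in>Pow S. bern p S Y * ((\<Sum>Z\<in>Pow (S - Y). H Y Z) / 2 ^ card (S - Y)))
    \<le> (\<integral>t. g t \<partial>arrival_times S)"
proof -
  let ?M = "arrival_times S" and ?I = "SIGMA Y:Pow S. Pow (S - Y)"
  interpret M: prob_space ?M
    unfolding arrival_times_def by (rule prob_space_PiM) (rule prob_space_unit)
  have "AE t in ?M. t e \<in> {0<..<1}" if "e \<in> S" for e
    unfolding arrival_times_def
    by (rule AE_PiM_component[OF prob_space_unit that]) (rule AE_uniform_measureI, auto)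
  then have "AE t in ?M. \<forall>e\<in>S. t e \<in> {0<..<1}" using S by (simp add: AE_finite_all)
  moreover have "AE t in ?M. t \<in> S \<rightarrow>\<^sub>E UNIV"
    using AE_space[of ?M] by (simp add: arrival_times_def space_PiM)
  ultimately have unit: "AE t in ?M. t \<in> S \<rightarrow>\<^sub>E {0<..<1}" by eventually_elim (auto simp: PiE_iff)
  have "integrable ?M g"
  proof (rule M.integrable_const_bound[OF _ g])
    show "AE t in ?M. norm (g t) \<le> C"
      using unit
    proof eventually_elim
      case (elim t)
      show ?case using ge[OF elim] le[OF elim] H order_trans[OF H ge[OF elim]] by simp
    qed
  qed
  have finI: "finite ?I" using S finite_subset by auto
  have int: "integrable ?M (\<lambda>t. indicator (cell S p x) t * case_prod H x)" for x
    using sets_cell[OF S] by (intro integrable_mult_left integrable_real_indicator) (auto simp: M.emeasure_eq_measure)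
  have "(\<integral>t. (\<Sum>x\<in>?I. indicator (cell S p x) t * case_prod H x) \<partial>?M) \<le> (\<integral>t. g t \<partial>?M)"
  proof (rule integral_mono_AE)
    show "integrable ?M (\<lambda>t. \<Sum>x\<in>?I. indicator (cell S p x) t * case_prod H x)"
      using int by (rule Bochner_Integration.integrable_sum)
    show "integrable ?M g" by fact
    show "AE t in ?M. (\<Sum>x\<in>?I. indicator (cell S p x) t * case_prod H x) \<le> g t"
      using unit
    proof eventually_elim
      case (elim t)
      let ?x = "({e \<in> S. t e \<in> {0<..<p}}, {e \<in> S. t e \<in> {(1 + p) / 2..<1}})"
      \<comment> \<open>A point of the open unit cube lies in just one cell, the one of its own
        split.\<close>
      have "(\<Sum>x\<in>?I. indicator (cell S p x) t * case_prod H x) = (\<Sum>x\<in>?I. if x = ?x then case_prod H ?x else 0)"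
      proof (rule sum.cong[OF refl])
        fix x assume x: "x \<in> ?I"
        obtain Y Z where YZ: "x = (Y, Z)" "Y \<subseteq> S" "Z \<subseteq> S - Y" using x by auto
        then have "t \<in> cell S p x \<longleftrightarrow> x = ?x" using mem_cell_iff[OF p elim YZ(2,3)] by auto
        then show "indicator (cell S p x) t * case_prod H x = (if x = ?x then case_prod H ?x else 0)"
          by (simp add: indicator_def)
      qed
      also have "\<dots> \<le> case_prod H ?x" using finI H by (simp add: sum.delta)
      also have "\<dots> \<le> g t" using ge[OF elim] by simp
      finally show ?case .
    qed
  qed
  also have "(\<integral>t. (\<Sum>x\<in>?I. indicator (cell S p x) t * case_prod H x) \<partial>?M)
    = (\<Sum>x\<in>?I. \<integral>t. indicator (cell S p x) t * case_prod H x \<partial>?M)"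
    using int by (rule Bochner_Integration.integral_sum)
  also have "\<dots> = (\<Sum>x\<in>?I. measure ?M (cell S p x) * case_prod H x)"
    using sets_cell[OF S] sets.sets_into_space by (intro sum.cong refl) (simp add: Int_absorb2)
  also have "\<dots> = (\<Sum>Y\<in>Pow S. \<Sum>Z\<in>Pow (S - Y). measure ?M (cell S p (Y, Z)) * H Y Z)"
    using S finite_subset by (subst sum.Sigma) (auto intro!: sum.cong)
  also have "\<dots> = (\<Sum>Y\<in>Pow S. \<Sum>Z\<in>Pow (S - Y). bern p S Y / 2 ^ card (S - Y) * H Y Z)"
    by (intro sum.cong refl) (simp add: measure_cell[OF S p])
  also have "\<dots> = (\<Sum>Y\<in>Pow S. bern p S Y * ((\<Sum>Z\<in>Pow (S - Y). H Y Z) / 2 ^ card (S - Y)))"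
    by (simp add: sum_distrib_left sum_divide_distrib)
  finally show ?thesis .
qed

section \<open>The expected weight of the returned set\<close>

context matroid_intersection
begin

text \<open>A condition sufficient for acceptance that depends only on the split, with
  \<open>Z\<close> as \<open>S2\<close> and \<open>S - Y - Z\<close> as \<open>S1\<close>.\<close>

definition accept :: "'a \<Rightarrow> 'a set \<Rightarrow> 'a set \<Rightarrow> bool" where
  "accept f Y Z \<longleftrightarrow> f \<in> rel Y \<and> f \<notin> clos (heavier (rel Y) (w f)) \<and> f \<in> Z
     \<and> dominates f (rel Y \<inter> (S - Y - Z)) (rel Y \<inter> Z - {f})"

text \<open>For fixed \<open>Y\<close>, an unspanned element of \<open>rel Y\<close> meets
  \<open>accept\<close> for at least a quarter of the \<open>2 ^ card (S - Y)\<close> sets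
  \<open>Z\<close>.\<close>

lemma sum_accept_ge:
  assumes p: "0 \<le> p" "p \<le> 1"
  shows "(\<Sum>x\<in>S. prob p (\<lambda>Y. x \<in> rel Y \<and> x \<notin> clos (heavier (rel Y) (w x))) * w x) / 4
    \<le> (\<Sum>Y\<in>Pow S. bern p S Y *
        ((\<Sum>Z\<in>Pow (S - Y). \<Sum>x\<in>S. of_bool (accept x Y Z) * w x) / 2 ^ card (S - Y)))"
proof -
  let ?q = "\<lambda>x Y. x \<in> rel Y \<and> x \<notin> clos (heavier (rel Y) (w x))"
  have "(\<Sum>x\<in>S. prob p (?q x) * w x) / 4
    = (\<Sum>x\<in>S. \<Sum>Y\<in>Pow S. bern p S Y * of_bool (?q x Y) * w x) / 4"
    by (simp only: prob_def sum_distrib_right)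
  also have "\<dots> = (\<Sum>Y\<in>Pow S. \<Sum>x\<in>S. bern p S Y * of_bool (?q x Y) * w x) / 4"
    by (subst sum.swap) simp
  also have "\<dots> = (\<Sum>Y\<in>Pow S. bern p S Y * (\<Sum>x\<in>S. of_bool (?q x Y) / 4 * w x))"
    by (simp add: sum_divide_distrib sum_distrib_left mult.assoc)
  also have "\<dots> \<le> (\<Sum>Y\<in>Pow S. bern p S Y * (\<Sum>x\<in>S.
      real (card {Z \<in> Pow (S - Y). accept x Y Z}) / 2 ^ card (S - Y) * w x))"
  proof (intro sum_mono mult_left_mono mult_right_mono bern_nonneg p nonneg)
    fix Y x assume Y: "Y \<in> Pow S" and x: "x \<in> S"
    show "of_bool (?q x Y) / 4 \<le> real (card {Z \<in> Pow (S - Y). accept x Y Z}) / 2 ^ card (S - Y)"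
    proof (cases "?q x Y")
      case True
      then have xT: "x \<in> S - Y" using rel_subset by blast
      have "{Z \<in> Pow (S - Y). accept x Y Z} = {Z \<in> Pow (S - Y). x \<in> Z
          \<and> dominates x (rel Y \<inter> (S - Y - Z)) (rel Y \<inter> Z - {x})}"
        using True by (auto simp: accept_def)
      then have "2 ^ card (S - Y) \<le> 4 * card {Z \<in> Pow (S - Y). accept x Y Z}"
        using card_dominated_splits[OF _ xT, of "rel Y"] finite_S by simp
      then have "real (2 ^ card (S - Y)) \<le> real (4 * card {Z \<in> Pow (S - Y). accept x Y Z})"
        by (simp only: of_nat_le_iff)
      then show ?thesis by (simp add: field_simps)
    next
      case False
      show ?thesis unfolding of_bool_def if_not_P[OF False] by simp
    qed
  qed
  also have "\<dots> = (\<Sum>Y\<in>Pow S. bern p S Y *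
        ((\<Sum>Z\<in>Pow (S - Y). \<Sum>x\<in>S. of_bool (accept x Y Z) * w x) / 2 ^ card (S - Y)))"
  proof (intro sum.cong refl arg_cong[where f = "\<lambda>x. bern p S _ * x"])
    fix Y
    have card: "real (card {Z \<in> Pow (S - Y). accept x Y Z}) = (\<Sum>Z\<in>Pow (S - Y). of_bool (accept x Y Z))" for x
      using finite_S by (simp add: Int_def)
    show "(\<Sum>x\<in>S. real (card {Z \<in> Pow (S - Y). accept x Y Z}) / 2 ^ card (S - Y) * w x)
      = (\<Sum>Z\<in>Pow (S - Y). \<Sum>x\<in>S. of_bool (accept x Y Z) * w x) / 2 ^ card (S - Y)"
      unfolding card by (subst sum.swap) (simp add: sum_distrib_right sum_divide_distrib)
  qed
  finally show ?thesis .
qed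

text \<open>Three losses multiply: \<open>(1 - p) / k\<close> for being relevant,
  \<open>1 - k * (1 - p)\<close> for being unspanned, and \<open>1 / 4\<close> for being accepted.
  The bound on \<open>k * (1 - p)\<close> keeps the second factor nonnegative.\<close>

lemma expected_weight_ge:
  fixes ALG :: "('a \<Rightarrow> real) \<Rightarrow> 'a set"
  assumes p: "0 < p" "p < 1" "real k * (1 - p) \<le> 1" and J: "J \<in> \<I>"
    and alg: "\<And>t. t \<in> S \<rightarrow>\<^sub>E {0<..<1} \<Longrightarrow> free_order_secretary S k Is w p t (ALG t)"
    and meas: "(\<lambda>t. sum w (ALG t)) \<in> borel_measurable (arrival_times S)"
  shows "(1 - real k * (1 - p)) * (1 - p) / (4 * real k) * sum w J
    \<le> (\<integral>t. sum w (ALG t) \<partial>arrival_times S)"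
proof -
  let ?R = "\<Sum>x\<in>S. prob p (\<lambda>Y. x \<in> rel Y) * w x"
  have "(1 - p) * sum w J / real k \<le> ?R"
    using expected_rel_weight[OF p(1) _ J] p k by (simp add: field_simps)
  then have "(1 - real k * (1 - p)) * ((1 - p) * sum w J / real k) / 4 \<le> (1 - real k * (1 - p)) * ?R / 4"
    using p by (intro divide_right_mono mult_left_mono) auto
  also have "\<dots> \<le> (\<Sum>x\<in>S. prob p (\<lambda>Y. x \<in> rel Y \<and> x \<notin> clos (heavier (rel Y) (w x))) * w x) / 4"
    using expected_unspanned_weight[of p] p by simp
  also have "\<dots> \<le> (\<Sum>Y\<in>Pow S. bern p S Y *
        ((\<Sum>Z\<in>Pow (S - Y). \<Sum>x\<in>S. of_bool (accept x Y Z) * w x) / 2 ^ card (S - Y)))"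
    by (rule sum_accept_ge) (use p in auto)
  also have "\<dots> \<le> (\<integral>t. sum w (ALG t) \<partial>arrival_times S)"
  proof (rule integral_arrival_times_ge[OF finite_S p(1,2) meas])
    show "0 \<le> (\<Sum>x\<in>S. of_bool (accept x Y Z) * w x)" for Y Z
      by (intro sum_nonneg mult_nonneg_nonneg nonneg) auto
    fix t :: "'a \<Rightarrow> real" assume t: "t \<in> S \<rightarrow>\<^sub>E {0<..<1}"
    let ?Y = "{e \<in> S. t e \<in> {0<..<p}}" and ?Z = "{e \<in> S. t e \<in> {(1 + p) / 2..<1}}"
    have S1: "{e \<in> S. t e \<in> {p..<(1 + p) / 2}} = S - ?Y - ?Z"
      using t p by (force simp: PiE_iff)
    have res: "fos_result S k Is w ?Y (S - ?Y - ?Z) ?Z (ALG t)"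
      using alg[OF t] unfolding free_order_secretary_def S1 .
    have sub: "ALG t \<subseteq> S" using indep_subset fos_result_indep[OF res] by blast
    show "sum w (ALG t) \<le> sum w S" by (rule sum_mono2[OF finite_S sub nonneg]) auto
    have "(\<Sum>x\<in>S. of_bool (accept x ?Y ?Z) * w x) \<le> (\<Sum>x\<in>S. of_bool (x \<in> ALG t) * w x)"
    proof (intro sum_mono mult_right_mono nonneg)
      fix x
      have "x \<in> ALG t" if "accept x ?Y ?Z"
        by (rule accepted[OF _ _ _ _ _ res]) (use that in \<open>auto simp: accept_def\<close>)
      then show "of_bool (accept x ?Y ?Z) \<le> (of_bool (x \<in> ALG t) :: real)" by simp
    qed
    also have "\<dots> = sum w (ALG t)" by (rule sum_of_bool_weight[OF sub])
    finally show "(\<Sum>x\<in>S. of_bool (accept x ?Y ?Z) * w x) \<le> sum w (ALG t)" .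
  qed
  finally show ?thesis by (simp add: mult.assoc)
qed

end

theorem corollary1:
  fixes S :: "'a set" and k :: nat and Is :: "nat \<Rightarrow> 'a set set" and w :: "'a \<Rightarrow> real"
    and OPT :: "'a set" and ALG :: "('a \<Rightarrow> real) \<Rightarrow> 'a set"
  assumes "k \<ge> 1"
    and "\<And>i. i \<in> {1..k} \<Longrightarrow> matroid S (Is i)"
    and "\<And>e. e \<in> S \<Longrightarrow> w e \<ge> 0"
    and "inj_on w S"
    and "is_arg_max (sum w) (\<lambda>X. X \<in> common_indep k Is) OPT"
    and "\<And>t. t \<in> S \<rightarrow>\<^sub>E {0<..<1} \<Longrightarrow>
           free_order_secretary S k Is w (1 - 1 / (2 * real k)) t (ALG t)"
    and "(\<lambda>t. sum w (ALG t)) \<in> borel_measurable (arrival_times S)"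
  shows "(\<forall>t \<in> S \<rightarrow>\<^sub>E {0<..<1}. ALG t \<in> common_indep k Is) \<and>
         (\<integral>t. sum w (ALG t) \<partial>arrival_times S) \<ge> 1 / (16 * (real k)\<^sup>2) * sum w OPT"
proof -
  interpret matroid_intersection S k Is w by standard (use assms in auto)
  let ?p = "1 - 1 / (2 * real k)"
  \<comment> \<open>This \<open>p\<close> maximizes \<open>(1 - k * (1 - p)) * (1 - p)\<close>. The
    factors \<open>1 / 2\<close>, \<open>1 / (2 * k)\<close> and \<open>1 / (4 * k)\<close> give the
    constant.\<close>
  have kq: "real k * (1 - ?p) = 1 / 2" using assms(1) by simp
  have p: "0 < ?p" "?p < 1" "real k * (1 - ?p) \<le> 1"
    using assms(1) unfolding kq by (simp_all add: field_simps)
  have "ALG t \<in> \<I>" if "t \<in> S \<rightarrow>\<^sub>E {0<..<1}" for t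
    using assms(6)[OF that] fos_result_indep unfolding free_order_secretary_def by blast
  moreover have "OPT \<in> \<I>" using assms(5) by (simp add: is_arg_max_def)
  from expected_weight_ge[OF p this assms(6,7)]
  have "(1 - 1 / 2) * (1 - ?p) / (4 * real k) * sum w OPT \<le> (\<integral>t. sum w (ALG t) \<partial>arrival_times S)"
    unfolding kq by blast
  moreover have "(1 - 1 / 2) * (1 - ?p) / (4 * real k) = 1 / (16 * (real k)\<^sup>2)"
    by (simp add: power2_eq_square)
  ultimately show ?thesis by simp
qed

end
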